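(* Let $x\in D_1$ and $\mu,\nu\in\mathbb{C}$ with $\nu+\mu\notin\mathbb{Z}$. Then $$\mathsf{Q}_\nu^\mu(x)=\frac{\pi}{2}\cot(\pi(\nu+\mu))\left(\frac{1+x}{1-x}\right)^{\frac12\mu}\frac{1}{\Gamma(1-\mu)}{}_2F_1\!\left(-\nu,\nu+1;1-\mu;\frac{1-x}{2}\right)-\frac{\pi}{2}\csc(\pi(\nu+\mu))\left(\frac{1-x}{1+x}\right)^{\frac12\mu}\frac{1}{\Gamma(1-\mu)}{}_2F_1\!\left(-\nu,\nu+1;1-\mu;\frac{1+x}{2}\right).$$
   Context: $\mathbb{N}=\{1,2,3,\dots\}$, $-\mathbb{N}=\{-1,-2,\dots\}$. $D_1=\mathbb{C}\setminus((-\infty,-1]\cup[1,\infty))$, $D_2=\mathbb{C}\setminus(-\infty,1]$. Complex powers are principal values. ${}_2F_1(a,b;c;w)$ is the Gauss hypergeometric function, principal branch on $\mathbb{C}\setminus[1,\infty)$ (the analytic continuation of $\sum_{n\ge0}\frac{(a)_n(b)_n}{(c)_n}\frac{w^n}{n!}$). $1/\Gamma$ is read as the entire function (zero at the poles of $\Gamma$), and a quotient ${}_2F_1(a,b;c;w)/\Gamma(c)$ with $c\in\{0,-1,-2,\dots\}$ is read as Olver's regularized function, the analytic continuation of $\sum_{n\ge0}\frac{(a)_n(b)_n}{\Gamma(c+n)}\frac{w^n}{n!}$. Associated Legendre function of the second kind: for $z\in D_2$, $\nu+\mu\in\mathbb{C}\setminus-\mathbb{N}$, $$Q_\nu^\mu(z)=\frac{\sqrt{\pi}\,e^{i\pi\mu}\Gamma(\nu+\mu+1)(z^2-1)^{\frac12\mu}}{2^{\nu+1}\Gamma(\nu+\frac32)z^{\nu+\mu+1}}\,{}_2F_1\!\left(\tfrac{\nu+\mu+2}{2},\tfrac{\nu+\mu+1}{2};\nu+\tfrac32;\tfrac1{z^2}\right),$$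 where $(z^2-1)^\alpha:=(z+1)^\alpha(z-1)^\alpha$. Ferrers function of the second kind: for $x\in(-1,1)$, $$\mathsf{Q}_\nu^\mu(x)=\tfrac12\big[e^{-\frac12 i\pi\mu}\,e^{-i\pi\mu}Q_\nu^\mu(x+i0)+e^{\frac12 i\pi\mu}\,e^{-i\pi\mu}Q_\nu^\mu(x-i0)\big],$$ where $x\pm i0$ denotes the limit from the upper/lower half-plane, and $\mathsf{Q}_\nu^\mu$ is extended analytically to $D_1$. *)

theory Defs
  imports "HOL-Complex_Analysis.Complex_Analysis"
begin

(* The slit plane D_1, on which the Ferrers functions are considered. *)

definition D1 :: "complex set" where
  "D1 = UNIV - of_real ` ({..-1} \<union> {1..})"

(* The analytic continuation to D of a function g given on S. It is characterised by its values
   on S if D is open and connected and S has a limit point in D; see continuation_eqI.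
   Its values outside D are unspecified. *)

definition continuation :: "complex set \<Rightarrow> complex set \<Rightarrow> (complex \<Rightarrow> complex) \<Rightarrow> complex \<Rightarrow> complex" where
  "continuation D S g = (SOME f. f holomorphic_on D \<and> (\<forall>z\<in>S. f z = g z))"

lemma continuation_eqI:
  assumes "open D" "connected D" "S \<subseteq> D" "\<xi> \<in> D" "\<xi> islimpt S"
    and f: "f holomorphic_on D" "\<And>z. z \<in> S \<Longrightarrow> f z = g z" and "z \<in> D"
  shows "continuation D S g z = f z"
proof -
  let ?h = "continuation D S g"
  have h: "?h holomorphic_on D \<and> (\<forall>z\<in>S. ?h z = g z)"
    unfolding continuation_def by (rule someI[of _ f]) (use f in auto)
  have "?h z - f z = 0"
  proof (rule analytic_continuation[of "\<lambda>z. ?h z - f z" D S \<xi>])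
    show "(\<lambda>z. ?h z - f z) holomorphic_on D"
      using h f by (auto intro: holomorphic_on_diff)
    show "?h w - f w = 0" if "w \<in> S" for w
      using h f that by simp
  qed (use assms in auto)
  then show ?thesis by simp
qed

(* Gauss's function and Olver's regularised function, both on the principal branch. *)

definition hyp2F1 :: "complex \<Rightarrow> complex \<Rightarrow> complex \<Rightarrow> complex \<Rightarrow> complex" where
  "hyp2F1 a b c = continuation (UNIV - of_real ` {1..}) (ball 0 1)
     (\<lambda>w. \<Sum>n. pochhammer a n * pochhammer b n / pochhammer c n * w ^ n / fact n)"

definition olver2F1 :: "complex \<Rightarrow> complex \<Rightarrow> complex \<Rightarrow> complex \<Rightarrow> complex" where
  "olver2F1 a b c = continuation (UNIV - of_real ` {1..}) (ball 0 1)
     (\<lambda>w. \<Sum>n. pochhammer a n * pochhammer b n * rGamma (c + of_nat n) * w ^ n / fact n)"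

(* The quotient 2F1(a, b; c; w) / Gamma(c), meaningful for every c. *)

definition hyp2F1_over_Gamma :: "complex \<Rightarrow> complex \<Rightarrow> complex \<Rightarrow> complex \<Rightarrow> complex" where
  "hyp2F1_over_Gamma a b c w =
     (if c \<in> \<int>\<^sub>\<le>\<^sub>0 then olver2F1 a b c w else hyp2F1 a b c w / Gamma c)"

(* Associated Legendre function of the second kind, for nu + mu not in {-1, -2, ...} and
   z outside (-oo, 1]. The factor Gamma(nu + 3/2) of the denominator is part of the last factor. *)

definition legendre_Q :: "complex \<Rightarrow> complex \<Rightarrow> complex \<Rightarrow> complex" where
  "legendre_Q \<nu> \<mu> z =
     of_real (sqrt pi) * exp (\<i> * of_real pi * \<mu>) * Gamma (\<nu> + \<mu> + 1)
       * ((z + 1) powr (\<mu> / 2) * (z - 1) powr (\<mu> / 2))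
       / (2 powr (\<nu> + 1) * z powr (\<nu> + \<mu> + 1))
       * hyp2F1_over_Gamma ((\<nu> + \<mu> + 2) / 2) ((\<nu> + \<mu> + 1) / 2) (\<nu> + 3 / 2) (1 / z\<^sup>2)"

(* Ferrers function of the second kind on the cut (-1, 1), from the boundary values Q(x + i0)
   and Q(x - i0), and its analytic extension to D1. *)

definition ferrers_Q_cut :: "complex \<Rightarrow> complex \<Rightarrow> complex \<Rightarrow> complex" where
  "ferrers_Q_cut \<nu> \<mu> x =
     (exp (- \<i> * of_real pi * \<mu> / 2) * exp (- \<i> * of_real pi * \<mu>)
        * Lim (at x within {z. Im z > 0}) (legendre_Q \<nu> \<mu>)
      + exp (\<i> * of_real pi * \<mu> / 2) * exp (- \<i> * of_real pi * \<mu>)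
        * Lim (at x within {z. Im z < 0}) (legendre_Q \<nu> \<mu>)) / 2"

definition ferrers_Q :: "complex \<Rightarrow> complex \<Rightarrow> complex \<Rightarrow> complex" where
  "ferrers_Q \<nu> \<mu> = continuation D1 (of_real ` {-1<..<1}) (ferrers_Q_cut \<nu> \<mu>)"

end

theory Submission
  imports Defs
begin

text \<open>
  For \<open>Re \<nu> > 0\<close> and \<open>Re s < 0\<close>, where \<open>s = \<nu> + \<mu> + 1\<close>, expanding \<open>(z - t) powr (- s)\<close> in powers of \<open>t\<close> shows that
  the integral of \<open>(1 - t\<^sup>2) powr \<nu> * (z - t) powr (- s)\<close> over \<open>[-1, 1]\<close> is, up to elementary factors, the Legendre
  function \<open>Q\<close>. For \<open>z\<close> in the upper half plane, Cauchy's theorem for the triangle \<open>-1, 1, z\<close>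
  moves the path to the two segments from \<open>-1\<close> to \<open>z\<close> and from \<open>z\<close> to \<open>1\<close>, and on each of these the
  integral is Euler's integral for the hypergeometric functions of \<open>(1 + z) / 2\<close> and \<open>(1 - z) / 2\<close>.
  The resulting connection formula is transported to all \<open>\<nu>\<close> and all non-integral \<open>s\<close> by two first-order
  differential operators, which raise \<open>s\<close> and lower \<open>\<nu>\<close> on both sides. The functions on its
  right-hand side are holomorphic on \<open>D1\<close>, so the boundary values on the cut can be read off; the
  two phases average to a cosine, and the reflection formula for \<open>Gamma\<close> gives the constants.
\<close>

section \<open>Complex beta integral\<close>

text \<open>\<open>continuation\<close> is a choice, so nothing is known about
  \<open>olver2F1\<close> until a holomorphic extension of the series is exhibited for every
  parameter triple; Euler's integral and the contiguous relations serve this purpose before they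
  serve the Legendre functions. Olver's normalisation is used throughout because its coefficients
  make sense for every \<open>c\<close>: \<open>1 - \<mu>\<close> and \<open>\<nu> + 3 / 2\<close>
  may then be nonpositive integers without separate treatment.

  Integer shifts of the parameters by differential operators require holomorphy in the variable
  only, whereas continuation in the parameters would call for holomorphy of \<open>olver2F1\<close>
  in them as well. The shift in \<open>s\<close> ends with a division by \<open>s\<close> and uses
  the functional equation of \<open>Gamma\<close> at \<open>- s\<close>; it is safe because the
  values of \<open>s\<close> that are visited differ by integers from a non-integer.

  The strict bounds on real parts make the beta, Euler and triangle integrands continuous up to the
  end points, so that no improper integral occurs there and Cauchy's theorem applies on the closed
  triangle.\<close>

definition beta_integral :: "complex \<Rightarrow> complex \<Rightarrow> complex" where
  "beta_integral a b = integral {0..1} (\<lambda>t::real. of_real t powr (a - 1) * of_real (1 - t) powr (b - 1))"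

text \<open>With real parts above 1 both exponents have positive real part, so the integrand tends
  to 0 at the ends, in agreement with \<open>0 powr _ = 0\<close>.\<close>

lemma continuous_on_beta_integrand:
  assumes "Re a > 1" "Re b > 1"
  shows "continuous_on {0..1} (\<lambda>t::real. complex_of_real t powr (a - 1) * of_real (1 - t) powr (b - 1))"
  using assms by (intro continuous_intros) auto

lemma has_integral_beta:
  assumes "Re a > 1" "Re b > 1"
  shows "((\<lambda>t::real. of_real t powr (a - 1) * of_real (1 - t) powr (b - 1)) has_integral beta_integral a b) {0..1}"
  unfolding beta_integral_def
  using integrable_continuous_real[OF continuous_on_beta_integrand[OF assms]]
  by (rule integrable_integral)

lemma powr_minus_one_mult:
  assumes "z \<noteq> (0::complex)"
  shows "z * z powr (a - 1) = z powr a"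
  using assms by (simp add: powr_diff)

text \<open>The derivative of \<open>t powr a * (1 - t) powr b\<close> integrates to 0, since this
  product vanishes at both ends; writing \<open>t = 1 - (1 - t)\<close> in its second term leaves
  two beta integrands.\<close>

lemma beta_integral_step:
  assumes "Re a > 1" "Re b > 1"
  shows "(a + b) * beta_integral a (b + 1) = b * beta_integral a b"
proof -
  let ?F = "\<lambda>t::real. complex_of_real t powr a * of_real (1 - t) powr b"
  have "((\<lambda>t::real. (a + b) * (of_real t powr (a - 1) * of_real (1 - t) powr (b + 1 - 1))
       - b * (of_real t powr (a - 1) * of_real (1 - t) powr (b - 1)))
        has_integral (?F 1 - ?F 0)) {0..1}"
  proof (rule fundamental_theorem_of_calculus_interior)
    show "continuous_on {0..1} ?F"
      using assms by (intro continuous_intros) auto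
  next
    fix t :: real assume t: "t \<in> {0<..<1}"
    let ?u = "complex_of_real t"
    have nz: "?u \<noteq> 0" "1 - ?u \<noteq> 0" using t by (auto simp: complex_eq_iff)
    have D: "((\<lambda>z. z powr a * (1 - z) powr b) has_field_derivative
           (a * ?u powr (a - 1) * (1 - ?u) powr b - ?u powr a * (b * (1 - ?u) powr (b - 1)))) (at ?u)"
      using t nz by (auto intro!: derivative_eq_intros simp: complex_nonpos_Reals_iff)
    have eq: "a * ?u powr (a - 1) * (1 - ?u) powr b - ?u powr a * (b * (1 - ?u) powr (b - 1))
       = (a + b) * (?u powr (a - 1) * (1 - ?u) powr (b + 1 - 1))
       - b * (?u powr (a - 1) * (1 - ?u) powr (b - 1))"
    proof -
      have "b + 1 - 1 = b" by simp
      then show ?thesis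
        unfolding powr_minus_one_mult[OF nz(1), of a, symmetric] powr_minus_one_mult[OF nz(2), of b, symmetric]
        by (simp add: powr_minus_one_mult[OF nz(2), of b, symmetric]) (simp add: ring_distribs)
    qed
    show "(?F has_vector_derivative ((a + b) * (of_real t powr (a - 1) * of_real (1 - t) powr (b + 1 - 1))
       - b * (of_real t powr (a - 1) * of_real (1 - t) powr (b - 1)))) (at t)"
      using has_vector_derivative_real_field[OF D] eq by simp
  qed auto
  moreover have "((\<lambda>t::real. (a + b) * (of_real t powr (a - 1) * of_real (1 - t) powr (b + 1 - 1))
       - b * (of_real t powr (a - 1) * of_real (1 - t) powr (b - 1)))
        has_integral ((a + b) * beta_integral a (b + 1) - b * beta_integral a b)) {0..1}"
    using assms by (intro has_integral_diff has_integral_mult_right has_integral_beta) auto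
  moreover have "?F 1 - ?F 0 = 0" using assms by auto
  ultimately show ?thesis
    by (metis (no_types, lifting) has_integral_unique right_minus_eq)
qed

lemma beta_integral_pochhammer:
  assumes "Re a > 1" "Re b > 1"
  shows "pochhammer (a + b) n * beta_integral a (b + of_nat n) = pochhammer b n * beta_integral a b"
proof (induction n)
  case (Suc n)
  have "pochhammer (a + b) (Suc n) * beta_integral a (b + of_nat (Suc n))
      = pochhammer (a + b) n * ((a + (b + of_nat n)) * beta_integral a ((b + of_nat n) + 1))"
    by (simp add: pochhammer_rec' algebra_simps)
  also have "\<dots> = pochhammer (a + b) n * ((b + of_nat n) * beta_integral a (b + of_nat n))"
    by (subst beta_integral_step) (use assms in auto)
  also have "\<dots> = pochhammer b (Suc n) * beta_integral a b"
    using Suc by (simp add: pochhammer_rec' algebra_simps)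
  finally show ?case .
qed simp

text \<open>The substitution \<open>v = n * t\<close>, with extension by 0 to the half-line,
  prepares the comparison with Euler's integral for \<open>Gamma a\<close>.\<close>

lemma has_integral_beta_scaled:
  assumes "Re a > 1" "Re b > 1" "n > 0"
  shows "((\<lambda>v. if v \<in> {0..real n} then of_real v powr (a - 1) * of_real (1 - v / n) powr (b - 1) else 0)
           has_integral (of_nat n powr a * beta_integral a b)) {0..}"
proof -
  have "((\<lambda>x. x / (1 / real n)) ` {0..1}) = {0..real n}"
    using assms(3) image_divide_atLeastAtMost[of "1 / real n" 0 1] by (simp add: field_simps)
  with has_integral_stretch_real[OF has_integral_beta[OF assms(1,2)], of "1 / real n"]
  have "((\<lambda>v. of_real (v / n) powr (a - 1) * of_real (1 - v / n) powr (b - 1)) has_integral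
      (real n *\<^sub>R beta_integral a b)) {0..real n}"
    using assms by simp
  then have "((\<lambda>v. of_nat n powr (a - 1) * (of_real (v / n) powr (a - 1) * of_real (1 - v / n) powr (b - 1))) has_integral
      (of_nat n powr (a - 1) * (real n *\<^sub>R beta_integral a b))) {0..real n}"
    by (rule has_integral_mult_right)
  also have "of_nat n powr (a - 1) * (real n *\<^sub>R beta_integral a b) = of_nat n powr a * beta_integral a b"
    using powr_minus_one_mult[of "of_nat n" a] assms(3)
    by (simp add: scaleR_conv_of_real mult.commute[of _ "of_nat n"] mult.assoc[symmetric])
  finally have "((\<lambda>v. of_real v powr (a - 1) * of_real (1 - v / n) powr (b - 1)) has_integral
      (of_nat n powr a * beta_integral a b)) {0..real n}"
  proof (rule has_integral_eq[rotated])
    fix v :: real assume v: "v \<in> {0..real n}"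
    have "of_nat n powr (a - 1) * complex_of_real (v / n) powr (a - 1) = (of_nat n * of_real (v / n)) powr (a - 1)"
      by (subst powr_times_real_left) auto
    also have "of_nat n * complex_of_real (v / n) = of_real v" using assms(3) by simp
    finally show "of_nat n powr (a - 1) * (complex_of_real (v / n) powr (a - 1) * of_real (1 - v / n) powr (b - 1))
      = of_real v powr (a - 1) * of_real (1 - v / n) powr (b - 1)" by (metis mult.assoc)
  qed
  then show ?thesis by (subst has_integral_restrict) auto
qed

lemma powr_of_nat_add:
  assumes "z \<noteq> 0 \<or> Re a > 0"
  shows "(z::complex) powr (a + of_nat n) = z powr a * z ^ n"
  using assms by (cases "z = 0") (auto simp: powr_add)

text \<open>After scaling, \<open>(1 - v / n) ^ n\<close> tends to \<open>exp (- v)\<close> and is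
  bounded by it, so dominated convergence applies with the real Gamma integrand as majorant. The
  shift by \<open>n + 2\<close> at scale \<open>n + 1\<close> is the one occurring in
  \<open>rGamma_series\<close> at index \<open>n + 1\<close>.\<close>

lemma beta_integral_limit:
  assumes "Re a > 1" "Re b > 1"
  shows "(\<lambda>n. of_nat (Suc n) powr a * beta_integral a (b + of_nat (Suc (Suc n)))) \<longlonglongrightarrow> Gamma a"
proof -
  let ?f = "\<lambda>n v. if v \<in> {0..real (Suc n)} then complex_of_real v powr (a - 1) *
              of_real (1 - v / Suc n) powr (b + of_nat (Suc (Suc n)) - 1) else 0"
  have int: "(?f n has_integral (of_nat (Suc n) powr a * beta_integral a (b + of_nat (Suc (Suc n))))) {0..}" for n
    using assms by (intro has_integral_beta_scaled) auto
  have h: "(\<lambda>v::real. v powr (Re a - 1) / exp v) integrable_on {0..}"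
    using Gamma_integral_real[of "Re a"] assms by (auto simp: integrable_on_def)
  have le: "norm (?f n v) \<le> v powr (Re a - 1) / exp v" if "v \<in> {0..}" for n v
  proof (cases "v \<le> real (Suc n)")
    case True
    let ?r = "1 - v / Suc n"
    have r: "0 \<le> ?r" "?r \<le> 1" using that True by (auto simp: field_simps)
    have "norm (complex_of_real ?r powr (b + of_nat (Suc (Suc n)) - 1))
        = norm (complex_of_real ?r powr ((b - 1) + of_nat (Suc (Suc n))))"
      by (simp add: algebra_simps)
    also have "\<dots> = norm (complex_of_real ?r powr (b - 1)) * norm (complex_of_real ?r ^ Suc (Suc n))"
      by (subst powr_of_nat_add) (use assms in \<open>auto simp: norm_mult\<close>)
    also have "\<dots> = ?r powr (Re b - 1) * ?r ^ Suc (Suc n)"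
      unfolding norm_power norm_of_real using r by (subst norm_powr_real_powr) auto
    also have "\<dots> \<le> 1 * ?r ^ Suc (Suc n)"
      using r assms by (intro mult_right_mono powr_le1) auto
    also have "\<dots> \<le> ?r ^ Suc n" using r by (simp add: mult_left_le_one_le)
    also have "\<dots> \<le> exp (- (v / Suc n)) ^ Suc n"
      using r exp_ge_add_one_self[of "- (v / Suc n)"] by (intro power_mono) auto
    also have "\<dots> = exp (- v)" unfolding exp_of_nat_mult[symmetric] by (simp add: field_simps)
    finally have "norm (complex_of_real ?r powr (b + of_nat (Suc (Suc n)) - 1)) \<le> exp (- v)" .
    moreover have "norm (complex_of_real v powr (a - 1)) = v powr (Re a - 1)"
      using that by (subst norm_powr_real_powr) auto
    ultimately show ?thesis using True that
      by (auto simp: norm_mult exp_minus divide_inverse intro!: mult_left_mono)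
  qed auto
  have conv: "(\<lambda>n. ?f n v) \<longlonglongrightarrow> of_real v powr (a - 1) / of_real (exp v)" if "v \<in> {0..}" for v
  proof -
    have ev: "eventually (\<lambda>n. v < real (Suc n)) sequentially"
      using eventually_gt_at_top[of "nat \<lceil>v\<rceil>"] by eventually_elim linarith
    have t0: "(\<lambda>n. 1 - v / Suc n) \<longlonglongrightarrow> 1"
      using tendsto_diff[OF tendsto_const, of "\<lambda>n. v / Suc n" 0 sequentially 1] LIMSEQ_Suc[OF lim_const_over_n[of v]]
      by simp
    have t1: "(\<lambda>n. complex_of_real (1 - v / Suc n)) \<longlonglongrightarrow> 1" using tendsto_of_real[OF t0] unfolding of_real_1 .
    have t2: "(\<lambda>n. complex_of_real (1 - v / Suc n) powr (b - 1)) \<longlonglongrightarrow> 1 powr (b - 1)"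
      using t1 by (intro tendsto_powr_complex) auto
    have "(\<lambda>n. (1 - v / Suc n) ^ Suc n) \<longlonglongrightarrow> exp (- v)"
      using LIMSEQ_Suc[OF tendsto_exp_limit_sequentially[of "-v"]] by simp
    from tendsto_mult[OF t0 this]
    have "(\<lambda>n. (1 - v / Suc n) ^ Suc (Suc n)) \<longlonglongrightarrow> exp (- v)" by simp
    from tendsto_mult[OF tendsto_const tendsto_mult[OF t2 tendsto_of_real[OF this]], of "of_real v powr (a - 1)"]
    have "(\<lambda>n. complex_of_real v powr (a - 1) * (complex_of_real (1 - v / Suc n) powr (b - 1) *
        of_real ((1 - v / Suc n) ^ Suc (Suc n)))) \<longlonglongrightarrow> of_real v powr (a - 1) / of_real (exp v)"
      by (simp add: exp_minus divide_inverse)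
    then show ?thesis
    proof (rule Lim_transform_eventually)
      show "eventually (\<lambda>n. complex_of_real v powr (a - 1) * (complex_of_real (1 - v / Suc n) powr (b - 1) *
        of_real ((1 - v / Suc n) ^ Suc (Suc n))) = ?f n v) sequentially"
        using ev
      proof eventually_elim
        case (elim n)
        have *: "b + of_nat (Suc (Suc n)) - 1 = (b - 1) + of_nat (Suc (Suc n))" by simp
        show ?case using that elim unfolding * 
          by (subst powr_of_nat_add) (use assms in auto)
      qed
    qed
  qed
  have G: "integral {0..} (\<lambda>t. of_real t powr (a - 1) / of_real (exp t)) = Gamma a"
    using Gamma_integral_complex[of a] assms by (intro integral_unique) auto
  have "(\<lambda>n. integral {0..} (?f n)) \<longlonglongrightarrow> integral {0..} (\<lambda>t. of_real t powr (a - 1) / of_real (exp t))"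
    by (rule dominated_convergence(2)[OF _ h le conv]) (use int in \<open>auto simp: integrable_on_def\<close>)
  then show ?thesis unfolding G using integral_unique[OF int] by simp
qed

text \<open>The recursion expresses the shifted integral through \<open>beta_integral a b\<close>
  and a quotient of Pochhammer symbols. Together with the power of \<open>n\<close> this is the
  quotient of the Gauss products for \<open>rGamma b\<close> and \<open>rGamma (a + b)\<close>, and
  the limit of the shifted integral is already known.\<close>

theorem beta_integral_eq:
  assumes "Re a > 1" "Re b > 1"
  shows "beta_integral a b = Gamma a * Gamma b * rGamma (a + b)"
proof -
  have nz: "b \<notin> \<int>\<^sub>\<le>\<^sub>0" "a + b \<notin> \<int>\<^sub>\<le>\<^sub>0"
    using assms by (auto elim!: nonpos_Ints_cases simp: complex_eq_iff)
  have "(\<lambda>n. rGamma_series b (Suc n) / rGamma_series (a + b) (Suc n) * beta_integral a b)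
     \<longlonglongrightarrow> rGamma b / rGamma (a + b) * beta_integral a b"
    using nz by (intro tendsto_intros LIMSEQ_Suc[OF rGamma_series_LIMSEQ]) (auto simp: rGamma_eq_zero_iff)
  moreover have "rGamma_series b (Suc n) / rGamma_series (a + b) (Suc n) * beta_integral a b
     = of_nat (Suc n) powr a * beta_integral a (b + of_nat (Suc (Suc n)))" for n
  proof -
    have "pochhammer (a + b) (Suc (Suc n)) \<noteq> 0"
      using nz by (auto simp: pochhammer_eq_0_iff)
    with beta_integral_pochhammer[OF assms, of "Suc (Suc n)"]
    have *: "beta_integral a (b + of_nat (Suc (Suc n)))
        = pochhammer b (Suc (Suc n)) * beta_integral a b / pochhammer (a + b) (Suc (Suc n))"
      by (simp add: field_simps)
    have ln: "complex_of_real (ln (real (Suc n))) = Ln (of_nat (Suc n))"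
      by (subst Ln_of_nat) auto
    show ?thesis unfolding * rGamma_series_def
      by (simp add: powr_def ln[symmetric] exp_add exp_diff field_simps del: of_nat_Suc pochhammer_Suc)
  qed
  ultimately have *: "rGamma b / rGamma (a + b) * beta_integral a b = Gamma a"
    using beta_integral_limit[OF assms] LIMSEQ_unique by (metis (no_types, lifting) ext)
  have "beta_integral a b = (rGamma b / rGamma (a + b) * beta_integral a b) * (1 / rGamma b) * rGamma (a + b)"
    using nz by (simp add: rGamma_eq_zero_iff)
  also have "1 / rGamma b = Gamma b" by (simp add: Gamma_def divide_inverse)
  finally show ?thesis unfolding * .
qed

section \<open>Continuation of the hypergeometric series\<close>

text \<open>On \<open>[-1, 1]\<close> the argument \<open>w * t\<close> stays in the disc of radius
  \<open>norm w\<close>, where the power series converges uniformly. The lemma serves both Euler's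
  integral on \<open>[0, 1]\<close> and the expansion on \<open>[-1, 1]\<close>.\<close>

lemma integral_powser_sums:
  fixes g :: "real \<Rightarrow> complex" and c :: "nat \<Rightarrow> complex"
  assumes g: "continuous_on {a..b} g" and ab: "-1 \<le> a" "b \<le> 1"
    and c: "1 \<le> conv_radius c" and w: "norm w < 1"
  shows "(\<lambda>n. c n * w ^ n * integral {a..b} (\<lambda>t. g t * of_real t ^ n)) sums
           integral {a..b} (\<lambda>t. g t * (\<Sum>n. c n * (w * of_real t) ^ n))"
proof -
  let ?S = "\<lambda>n z. \<Sum>i<n. c i * z ^ i"
  have r: "ereal (norm w) < conv_radius c"
    using c w by (metis ereal_less(3) less_le_trans one_ereal_def less_ereal.simps(1))
  have "uniform_limit (cball 0 (norm w)) ?S (\<lambda>x. \<Sum>i. c i * x ^ i) sequentially"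
    using powser_uniform_limit[OF r, of 0] by simp
  then have U: "uniform_limit {a..b} (\<lambda>n t. ?S n (w * of_real t)) (\<lambda>t. \<Sum>i. c i * (w * of_real t) ^ i) sequentially"
  proof (rule uniform_limit_compose')
    show "(\<lambda>t. w * complex_of_real t) \<in> {a..b} \<rightarrow> cball 0 (norm w)"
      using ab by (auto simp: norm_mult intro!: mult_left_le)
  qed
  have cont: "continuous_on {a..b} (\<lambda>t. \<Sum>i. c i * (w * of_real t) ^ i)"
    by (rule uniform_limit_theorem[OF _ U]) (auto intro!: always_eventually continuous_intros)
  have "uniform_limit {a..b} (\<lambda>n t. g t * ?S n (w * of_real t)) (\<lambda>t. g t * (\<Sum>i. c i * (w * of_real t) ^ i)) sequentially"
    by (intro uniform_lim_mult uniform_limit_const U compact_imp_bounded compact_continuous_image g cont) auto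
  moreover have "continuous_on {a..b} (\<lambda>t. g t * ?S n (w * of_real t))" for n
    using g by (intro continuous_intros)
  ultimately obtain I J where I: "\<And>n. ((\<lambda>t. g t * ?S n (w * of_real t)) has_integral I n) {a..b}"
    "((\<lambda>t. g t * (\<Sum>i. c i * (w * of_real t) ^ i)) has_integral J) {a..b}" "I \<longlonglongrightarrow> J"
    using uniform_limit_integral[OF _ _ sequentially_bot] by blast
  have "I n = (\<Sum>i<n. c i * w ^ i * integral {a..b} (\<lambda>t. g t * of_real t ^ i))" for n
  proof -
    have "((\<lambda>t. \<Sum>i<n. c i * w ^ i * (g t * of_real t ^ i)) has_integral
            (\<Sum>i<n. c i * w ^ i * integral {a..b} (\<lambda>t. g t * of_real t ^ i))) {a..b}"
      using g by (intro has_integral_sum has_integral_mult_right integrable_integral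
          integrable_continuous_real) (auto intro!: continuous_intros)
    also have "(\<lambda>t. \<Sum>i<n. c i * w ^ i * (g t * of_real t ^ i)) = (\<lambda>t. g t * ?S n (w * of_real t))"
      by (simp add: sum_distrib_left power_mult_distrib mult_ac)
    finally show ?thesis using I(1) has_integral_unique by blast
  qed
  then have "(\<lambda>n. \<Sum>i<n. c i * w ^ i * integral {a..b} (\<lambda>t. g t * of_real t ^ i)) \<longlonglongrightarrow> J"
    using I(3) by presburger
  then show ?thesis unfolding sums_def integral_unique[OF I(2)] .
qed

section \<open>The slit plane of the hypergeometric function\<close>

definition slit :: "complex set" where
  "slit = UNIV - of_real ` {1..}"

lemma slit_iff: "z \<in> slit \<longleftrightarrow> 1 - z \<notin> \<real>\<^sub>\<le>\<^sub>0"
proof -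
  have "z \<in> of_real ` {1..} \<longleftrightarrow> 1 - z \<in> \<real>\<^sub>\<le>\<^sub>0"
  proof
    assume "1 - z \<in> \<real>\<^sub>\<le>\<^sub>0"
    then have "z = of_real (Re z)" "Re z \<in> {1..}"
      by (auto simp: complex_nonpos_Reals_iff complex_eq_iff)
    then show "z \<in> of_real ` {1..}" by blast
  qed (auto simp: complex_nonpos_Reals_iff)
  then show ?thesis by (auto simp: slit_def)
qed

lemma slit_iff': "z \<in> slit \<longleftrightarrow> Im z \<noteq> 0 \<or> Re z < 1"
  by (auto simp: slit_iff complex_nonpos_Reals_iff)

lemma open_slit: "open slit"
proof -
  have "slit = (\<lambda>z. 1 - z) -` (- \<real>\<^sub>\<le>\<^sub>0)" by (auto simp: slit_iff)
  moreover have "open ((\<lambda>z::complex. 1 - z) -` (- \<real>\<^sub>\<le>\<^sub>0))"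
    by (intro continuous_open_vimage continuous_intros) auto
  ultimately show ?thesis by simp
qed

lemma slit_mult:
  assumes "z \<in> slit" "0 \<le> t" "t \<le> 1"
  shows "z * of_real t \<in> slit"
proof (cases "Im z = 0 \<and> t \<noteq> 0")
  case True
  then have "Re z < 1" using assms by (auto simp: slit_iff')
  moreover have "Re z * t \<le> max 0 (Re z)"
    using assms mult_left_le[of t "Re z"] mult_nonpos_nonneg[of "Re z" t] by (cases "Re z \<ge> 0") auto
  ultimately have "Re z * t < 1" by linarith
  then show ?thesis by (simp add: slit_iff')
qed (use assms in \<open>auto simp: slit_iff'\<close>)

lemma starlike_connected_mult:
  assumes "\<And>z t. z \<in> S \<Longrightarrow> 0 \<le> t \<Longrightarrow> t \<le> 1 \<Longrightarrow> z * of_real t \<in> (S::complex set)" "0 \<in> S"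
  shows "connected S"
proof (rule starlike_imp_connected)
  have "closed_segment 0 z \<subseteq> S" if "z \<in> S" for z
    using assms(1)[OF that] by (auto simp: closed_segment_def scaleR_conv_of_real mult.commute)
  with assms(2) show "starlike S" by (auto simp: starlike_def)
qed

lemma connected_slit: "connected slit"
  using slit_mult by (intro starlike_connected_mult) (auto simp: slit_iff')

lemma ball_subset_slit: "ball 0 1 \<subseteq> slit"
proof
  fix z :: complex assume "z \<in> ball 0 1"
  then have "Re z < 1" using complex_Re_le_cmod[of z] by auto
  then show "z \<in> slit" by (simp add: slit_iff')
qed

lemma zero_islimpt_ball: "(0::complex) islimpt ball 0 1"
  by (intro interior_limit_point) auto

section \<open>Coefficients and extensions of the regularised series\<close>

definition olver_coeff :: "complex \<Rightarrow> complex \<Rightarrow> complex \<Rightarrow> nat \<Rightarrow> complex" where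
  "olver_coeff a b c n = pochhammer a n * pochhammer b n * rGamma (c + of_nat n) / fact n"

text \<open>Multiplied out instead of written as a quotient, the recursion also covers
  \<open>c + n = 0\<close>.\<close>

lemma olver_coeff_Suc:
  "of_nat (Suc n) * (c + of_nat n) * olver_coeff a b c (Suc n) = (a + of_nat n) * (b + of_nat n) * olver_coeff a b c n"
proof -
  have "(c + of_nat n) * rGamma (c + of_nat (Suc n)) = rGamma (c + of_nat n)"
    using rGamma_plus1[of "c + of_nat n"] by (simp add: algebra_simps)
  moreover have "S * C * (x * p * (y * q) * R / (S * F)) = x * y * (p * q * (C * R) / F)"
    if "S \<noteq> 0" "F \<noteq> 0" for S C x p y q R F :: complex
    using that by simp
  ultimately show ?thesis
    unfolding olver_coeff_def pochhammer_rec' fact_Suc of_nat_mult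
    by (metis fact_nonzero of_nat_neq_0)
qed

text \<open>Coefficients may vanish, for instance for a terminating series, so the ratio test is
  used as an inequality without division by coefficients.\<close>

lemma conv_radius_olver_coeff: "1 \<le> conv_radius (olver_coeff a b c)"
proof (rule conv_radius_geI_ex')
  fix r :: real assume r: "0 < r" "ereal r < 1"
  then have r1: "r < 1" by simp
  let ?A = "\<lambda>n. olver_coeff a b c n * of_real r ^ n"
  \<comment> \<open>The ratios tend to \<open>r\<close>, and \<open>q\<close> is the midpoint
    between \<open>r\<close> and 1; the later bound \<open>n > norm c\<close> keeps
    \<open>c + n\<close> away from 0.\<close>
  define q where "q = (1 + r) / 2"
  have q: "q < 1" "r < q" using r1 by (auto simp: q_def)
  have "(\<lambda>n. r * (norm ((a + of_nat n) / of_nat n) * norm ((b + of_nat n) / of_nat n) /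
      (norm ((c + of_nat n) / of_nat n) * norm ((of_nat (Suc n) :: complex) / of_nat n)))) \<longlonglongrightarrow> r * (norm (1::complex) * norm (1::complex) / (norm (1::complex) * norm (1::complex)))"
  proof (intro tendsto_intros)
    have lim: "(\<lambda>n. (d + of_nat n) / of_nat n) \<longlonglongrightarrow> (1::complex)" for d :: complex
    proof (rule Lim_transform_eventually)
      show "(\<lambda>n. d / of_nat n + 1) \<longlonglongrightarrow> 1"
        using tendsto_add[OF lim_const_over_n[of d] tendsto_const, of 1] by simp
      show "eventually (\<lambda>n. d / of_nat n + 1 = (d + of_nat n) / of_nat n) sequentially"
        using eventually_gt_at_top[of "0::nat"] by eventually_elim (simp add: field_simps)
    qed
    show "(\<lambda>n. (a + of_nat n) / of_nat n) \<longlonglongrightarrow> 1" "(\<lambda>n. (b + of_nat n) / of_nat n) \<longlonglongrightarrow> 1"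
      "(\<lambda>n. (c + of_nat n) / of_nat n) \<longlonglongrightarrow> 1" by (rule lim)+
    show "(\<lambda>n. (of_nat (Suc n) :: complex) / of_nat n) \<longlonglongrightarrow> 1" using lim[of 1] by simp
  qed auto
  then have "eventually (\<lambda>n. r * (norm ((a + of_nat n) / of_nat n) * norm ((b + of_nat n) / of_nat n) /
      (norm ((c + of_nat n) / of_nat n) * norm ((of_nat (Suc n) :: complex) / of_nat n))) < q) sequentially"
    using q by (intro order_tendstoD(2)) auto
  moreover have "eventually (\<lambda>n. real n > norm c) sequentially"
    using eventually_gt_at_top[of "nat \<lceil>norm c\<rceil>"] by eventually_elim linarith
  ultimately have "eventually (\<lambda>n. norm (?A (Suc n)) \<le> q * norm (?A n)) sequentially"
  proof eventually_elim
    case (elim n)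
    have n: "n > 0" using elim(2) norm_ge_zero[of c] by linarith
    have cn: "norm (c + of_nat n) > 0"
    proof -
      have "c + of_nat n \<noteq> 0"
      proof
        assume "c + of_nat n = 0"
        then have "c = - of_nat n" by (simp add: eq_neg_iff_add_eq_0)
        then show False using elim(2) by simp
      qed
      then show ?thesis by simp
    qed
    let ?s = "norm (of_nat (Suc n) :: complex)"
    have s: "?s > 0" by (simp del: of_nat_Suc)
    have "r * (norm (a + of_nat n) * norm (b + of_nat n) / (norm (c + of_nat n) * ?s)) < q"
      using elim(1) n by (simp add: norm_divide field_simps del: of_nat_Suc)
    then have 1: "r * (norm (a + of_nat n) * norm (b + of_nat n)) \<le> q * (norm (c + of_nat n) * ?s)"
      using cn s by (simp add: field_simps del: of_nat_Suc)
    have "?s * norm (c + of_nat n) * norm (?A (Suc n)) = norm (of_nat (Suc n) * (c + of_nat n) * olver_coeff a b c (Suc n)) * r * r ^ n"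
      using r by (simp add: norm_mult norm_power del: of_nat_Suc)
    also have "\<dots> = r * (norm (a + of_nat n) * norm (b + of_nat n)) * norm (?A n)"
      unfolding olver_coeff_Suc using r by (simp add: norm_mult norm_power)
    also have "\<dots> \<le> q * (norm (c + of_nat n) * ?s) * norm (?A n)"
      using 1 by (intro mult_right_mono) auto
    finally have "(?s * norm (c + of_nat n)) * norm (?A (Suc n)) \<le> (?s * norm (c + of_nat n)) * (q * norm (?A n))"
      by (simp add: mult_ac)
    then show ?case using cn s by (simp only: mult_le_cancel_left_pos mult_pos_pos)
  qed
  then obtain N where "\<forall>n\<ge>N. norm (?A (Suc n)) \<le> q * norm (?A n)"
    by (auto simp: eventually_at_top_linorder)
  then show "summable ?A" using q by (intro summable_ratio_test[of q N]) auto
qed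

lemma summable_olver_coeff:
  assumes "norm w < 1"
  shows "summable (\<lambda>n. olver_coeff a b c n * w ^ n)"
proof (rule summable_in_conv_radius)
  have "ereal (norm w) < 1" using assms by simp
  then show "ereal (norm w) < conv_radius (olver_coeff a b c)" using conv_radius_olver_coeff[of a b c] by (rule less_le_trans)
qed

text \<open>Describes a candidate for the continuation without mentioning the choice operator. Any
  candidate agrees with \<open>olver2F1\<close> on \<open>slit\<close>, so a relation between
  contiguous functions can be proved by showing that one side is a candidate for the parameters of
  the other.\<close>

definition olver_germ :: "complex \<Rightarrow> complex \<Rightarrow> complex \<Rightarrow> (complex \<Rightarrow> complex) \<Rightarrow> bool" where
  "olver_germ a b c f \<longleftrightarrow> f holomorphic_on slit \<and>
     (\<forall>w\<in>ball 0 1. (\<lambda>n. olver_coeff a b c n * w ^ n) sums f w)"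

lemma olver_germ_eq:
  assumes "olver_germ a b c f" "w \<in> slit"
  shows "olver2F1 a b c w = f w"
  unfolding olver2F1_def slit_def[symmetric]
proof (rule continuation_eqI[OF open_slit connected_slit ball_subset_slit _ zero_islimpt_ball])
  show "f holomorphic_on slit" using assms by (simp add: olver_germ_def)
  show "f z = (\<Sum>n. pochhammer a n * pochhammer b n * rGamma (c + of_nat n) * z ^ n / fact n)" if "z \<in> ball 0 1" for z
    using assms(1) that by (auto simp: olver_germ_def olver_coeff_def sums_iff field_simps)
qed (use assms in \<open>auto simp: slit_iff'\<close>)

lemma olver_germ_cong:
  assumes "olver_germ a b c f" "\<And>z. z \<in> slit \<Longrightarrow> g z = f z"
  shows "olver_germ a b c g"
  using assms(1) assms(2) ball_subset_slit holomorphic_cong[OF refl assms(2)]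
  by (auto simp: olver_germ_def)

text \<open>Every contiguous relation used below has this shape. On coefficients, \<open>w \<cdot> deriv f w\<close> is
  multiplication by the index, so that the relation is checked term by term.\<close>

lemma olver_germ_shift:
  assumes f: "olver_germ a b c f"
    and 0: "olver_coeff a' b' c' 0 = q0 * olver_coeff a b c 0"
    and Suc: "\<And>n. olver_coeff a' b' c' (Suc n) =
        (p0 * of_nat (Suc n) + q0) * olver_coeff a b c (Suc n) + (p1 * of_nat n + q1) * olver_coeff a b c n"
  shows "olver_germ a' b' c' (\<lambda>w. (p0 + p1 * w) * (w * deriv f w) + (q0 + q1 * w) * f w)"
  unfolding olver_germ_def
proof (intro conjI ballI)
  let ?A = "olver_coeff a b c" and ?B = "olver_coeff a' b' c'"
  have fh: "f holomorphic_on slit" and fs: "\<And>w. w \<in> ball 0 1 \<Longrightarrow> (\<lambda>n. ?A n * w ^ n) sums f w"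
    using f by (auto simp: olver_germ_def)
  show "(\<lambda>w. (p0 + p1 * w) * (w * deriv f w) + (q0 + q1 * w) * f w) holomorphic_on slit"
    using fh open_slit by (intro holomorphic_intros) auto
  fix w :: complex assume w: "w \<in> ball 0 1"
  have D: "((\<lambda>w. \<Sum>n. ?A n * w ^ n) has_field_derivative (\<Sum>n. diffs ?A n * w ^ n)) (at w)"
    by (rule termdiffs_strong'[where K = 1]) (use w summable_olver_coeff in auto)
  have "(f has_field_derivative (\<Sum>n. diffs ?A n * w ^ n)) (at w)"
    by (rule has_field_derivative_transform_within_open[OF D open_ball w])
       (use fs in \<open>auto simp: sums_iff\<close>)
  then have df: "deriv f w = (\<Sum>n. diffs ?A n * w ^ n)" by (rule DERIV_imp_deriv)
  have "summable (\<lambda>n. diffs ?A n * w ^ n)"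
    by (rule termdiff_converges[where K = 1]) (use w summable_olver_coeff in auto)
  then have "(\<lambda>n. diffs ?A n * w ^ n) sums deriv f w" by (simp add: df summable_sums)
  from sums_mult[OF this, of w] have d1: "(\<lambda>n. of_nat (Suc n) * ?A (Suc n) * w ^ Suc n) sums (w * deriv f w)"
    by (simp add: diffs_def algebra_simps)
  then have d0: "(\<lambda>n. of_nat n * ?A n * w ^ n) sums (w * deriv f w)"
    using sums_Suc_iff[of "\<lambda>n. of_nat n * ?A n * w ^ n"] by simp
  have f0: "(\<lambda>n. ?A n * w ^ n) sums f w" using fs w .
  have f1: "(\<lambda>n. ?A (Suc n) * w ^ Suc n) sums (f w - ?A 0)"
    using f0 sums_Suc_iff[of "\<lambda>n. ?A n * w ^ n" "f w - ?A 0"] by simp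
  have "(\<lambda>n. p0 * (of_nat (Suc n) * ?A (Suc n) * w ^ Suc n) + q0 * (?A (Suc n) * w ^ Suc n)
          + (p1 * w * (of_nat n * ?A n * w ^ n) + q1 * w * (?A n * w ^ n)))
       sums (p0 * (w * deriv f w) + q0 * (f w - ?A 0) + (p1 * w * (w * deriv f w) + q1 * w * f w))"
    by (intro sums_add sums_mult d0 d1 f0 f1)
  also have "(\<lambda>n. p0 * (of_nat (Suc n) * ?A (Suc n) * w ^ Suc n) + q0 * (?A (Suc n) * w ^ Suc n)
          + (p1 * w * (of_nat n * ?A n * w ^ n) + q1 * w * (?A n * w ^ n))) = (\<lambda>n. ?B (Suc n) * w ^ Suc n)"
    unfolding Suc by (simp add: algebra_simps)
  finally show "(\<lambda>n. ?B n * w ^ n) sums ((p0 + p1 * w) * (w * deriv f w) + (q0 + q1 * w) * f w)"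
    using sums_Suc_iff[of "\<lambda>n. ?B n * w ^ n"] 0 by (simp add: algebra_simps)
qed

lemma Re_pos_not_nonpos_Int: "Re z > 0 \<Longrightarrow> z \<notin> \<int>\<^sub>\<le>\<^sub>0"
  by (auto elim!: nonpos_Ints_cases)

section \<open>Euler's integral\<close>

lemma powr_one_minus_sums:
  fixes z a :: complex
  assumes "norm z < 1"
  shows "(\<lambda>n. pochhammer a n / fact n * z ^ n) sums ((1 - z) powr (- a))"
proof -
  have "pochhammer a n = pochhammer (- (- a)) n" for n by simp
  then have "((- a) gchoose n) * (- z) ^ n = pochhammer a n / fact n * z ^ n" for n
    unfolding gbinomial_pochhammer by (simp add: power_minus[of z])
  with gen_binomial_complex[of "- z" "- a"] assms show ?thesis by simp
qed

lemma conv_radius_pochhammer: "1 \<le> conv_radius (\<lambda>n. pochhammer a n / fact n :: complex)"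
proof (rule conv_radius_geI_ex')
  fix r :: real assume "0 < r" "ereal r < 1"
  then show "summable (\<lambda>n. pochhammer a n / fact n * complex_of_real r ^ n)"
    using powr_one_minus_sums[of "of_real r" a] by (auto simp: sums_iff)
qed

lemma holomorphic_integral_powr:
  fixes g :: "real \<Rightarrow> complex"
  assumes "continuous_on {0..1} g"
  shows "(\<lambda>w. integral {0..1} (\<lambda>t. g t * (1 - w * of_real t) powr a)) holomorphic_on slit"
proof -
  have mem: "1 - w * of_real t \<notin> \<real>\<^sub>\<le>\<^sub>0" if "w \<in> slit" "t \<in> {0..1}" for w t
    using slit_mult[of w t] that by (simp add: slit_iff)
  \<comment> \<open>The Leibniz rule asks for a convex set, which \<open>slit\<close> is not;
    holomorphy is local, so balls inside \<open>slit\<close> suffice.\<close>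
  have loc: "(\<lambda>w. integral {0..1} (\<lambda>t. g t * (1 - w * of_real t) powr a)) holomorphic_on U"
    if U: "U \<subseteq> slit" "convex U" for U
  proof -
    have "(\<lambda>w. integral (cbox 0 1) (\<lambda>t. g t * (1 - w * of_real t) powr a)) holomorphic_on U"
    proof (rule leibniz_rule_holomorphic[OF _ _ _ U(2)])
      fix w and t :: real assume wt: "w \<in> U" "t \<in> cbox 0 1"
      then have "1 - w * of_real t \<notin> \<real>\<^sub>\<le>\<^sub>0" using mem U by auto
      then show "((\<lambda>w. g t * (1 - w * of_real t) powr a) has_field_derivative
          (g t * (a * (1 - w * of_real t) powr (a - 1) * (- of_real t)))) (at w within U)"
        by (auto intro!: derivative_eq_intros)
    next
      fix w assume "w \<in> U"
      then have "\<forall>t\<in>{0..1}. 1 - w * complex_of_real t \<notin> \<real>\<^sub>\<le>\<^sub>0" using mem U by auto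
      moreover from this have "\<forall>t\<in>{0..1}. 1 - w * complex_of_real t \<noteq> 0" by force
      ultimately show "(\<lambda>t. g t * (1 - w * of_real t) powr a) integrable_on cbox 0 1"
        unfolding cbox_interval
        by (intro integrable_continuous_real continuous_intros assms) (auto simp: complex_nonpos_Reals_iff)
    next
      have "\<forall>p\<in>U \<times> {0..1}. 1 - fst p * complex_of_real (snd p) \<notin> \<real>\<^sub>\<le>\<^sub>0" using mem U by auto
      moreover from this have "\<forall>p\<in>U \<times> {0..1}. 1 - fst p * complex_of_real (snd p) \<noteq> 0" by force
      ultimately show "continuous_on (U \<times> cbox 0 1) (\<lambda>(w, t). g t * (a * (1 - w * of_real t) powr (a - 1) * (- of_real t)))"
        unfolding case_prod_unfold cbox_interval
        by (intro continuous_intros continuous_on_compose2[OF assms]) 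
           (auto simp: complex_nonpos_Reals_iff)
    qed
    then show ?thesis by (simp add: cbox_interval)
  qed
  show ?thesis
    unfolding holomorphic_on_open[OF open_slit]
  proof
    fix w assume "w \<in> slit"
    then obtain e where e: "e > 0" "ball w e \<subseteq> slit" using open_slit openE by blast
    from loc[OF e(2)] e(1) show "\<exists>f'. ((\<lambda>w. integral {0..1} (\<lambda>t. g t * (1 - w * of_real t) powr a)) has_field_derivative f') (at w)"
      unfolding holomorphic_on_open[OF open_ball] by auto
  qed
qed

text \<open>Expanding \<open>(1 - w * t) powr (- a)\<close> in powers of \<open>w * t\<close> turns
  the integral into a series of moments \<open>beta_integral (b + n) (c - b)\<close>. Their values
  contain \<open>rGamma (c + n)\<close>, which is why the regularised function appears
  directly.\<close>

lemma olver_germ_Euler: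
  assumes "Re b > 1" "Re (c - b) > 1"
  shows "olver_germ a b c (\<lambda>w. rGamma b * rGamma (c - b) *
      integral {0..1} (\<lambda>t. of_real t powr (b - 1) * of_real (1 - t) powr (c - b - 1) * (1 - w * of_real t) powr (- a)))"
  unfolding olver_germ_def
proof (intro conjI ballI)
  let ?g = "\<lambda>t::real. of_real t powr (b - 1) * complex_of_real (1 - t) powr (c - b - 1)"
  have g: "continuous_on {0..1} ?g" using assms by (intro continuous_on_beta_integrand) auto
  show "(\<lambda>w. rGamma b * rGamma (c - b) * integral {0..1} (\<lambda>t. ?g t * (1 - w * of_real t) powr (- a))) holomorphic_on slit"
    by (intro holomorphic_intros holomorphic_integral_powr g)
  fix w :: complex assume "w \<in> ball 0 1"
  then have w: "norm w < 1" by simp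
  have nz: "rGamma b \<noteq> 0" "rGamma (c - b) \<noteq> 0"
    using Re_pos_not_nonpos_Int[of b] Re_pos_not_nonpos_Int[of "c - b"] assms
    by (auto simp: rGamma_eq_zero_iff)
  have moment: "integral {0..1} (\<lambda>t. ?g t * of_real t ^ n) = pochhammer b n * rGamma (c + of_nat n) / (rGamma b * rGamma (c - b))" for n
  proof -
    have "integral {0..1} (\<lambda>t. ?g t * of_real t ^ n) = beta_integral (b + of_nat n) (c - b)"
      unfolding beta_integral_def
    proof (rule integral_cong)
      fix t :: real
      have "b + of_nat n - 1 = (b - 1) + of_nat n" by simp
      then have "complex_of_real t powr (b + of_nat n - 1) = of_real t powr (b - 1) * of_real t ^ n"
        using powr_of_nat_add[of "of_real t" "b - 1" n] assms by (simp only:) simp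
      then show "?g t * of_real t ^ n = of_real t powr (b + of_nat n - 1) * of_real (1 - t) powr (c - b - 1)"
        by simp
    qed
    also have "\<dots> = Gamma (b + of_nat n) * Gamma (c - b) * rGamma (b + of_nat n + (c - b))"
      using assms by (intro beta_integral_eq) auto
    also have "Gamma (b + of_nat n) = pochhammer b n / rGamma b"
    proof -
      have "rGamma (b + of_nat n) \<noteq> 0" using pochhammer_rGamma[of b n] nz by auto
      then show ?thesis using pochhammer_rGamma[of b n] nz unfolding Gamma_def by (simp add: field_simps)
    qed
    also have "Gamma (c - b) = 1 / rGamma (c - b)" by (simp add: Gamma_def divide_inverse)
    also have "b + of_nat n + (c - b) = c + of_nat n" by simp
    finally show ?thesis by simp
  qed
  have "integral {0..1} (\<lambda>t. ?g t * (\<Sum>n. pochhammer a n / fact n * (w * of_real t) ^ n))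
      = integral {0..1} (\<lambda>t. ?g t * (1 - w * of_real t) powr (- a))"
  proof (rule integral_cong)
    fix t :: real assume t: "t \<in> {0..1}"
    have "norm (w * of_real t) \<le> norm w" using t by (auto simp: norm_mult intro!: mult_left_le)
    with w have "norm (w * of_real t) < 1" by linarith
    from powr_one_minus_sums[OF this, of a]
    show "?g t * (\<Sum>n. pochhammer a n / fact n * (w * of_real t) ^ n) = ?g t * (1 - w * of_real t) powr (- a)"
      by (simp add: sums_iff)
  qed
  with integral_powser_sums[OF g _ _ conv_radius_pochhammer w, of a]
  have "(\<lambda>n. pochhammer a n / fact n * w ^ n * (pochhammer b n * rGamma (c + of_nat n) / (rGamma b * rGamma (c - b))))
      sums integral {0..1} (\<lambda>t. ?g t * (1 - w * of_real t) powr (- a))"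
    unfolding moment by simp
  from sums_mult[OF this, of "rGamma b * rGamma (c - b)"]
  show "(\<lambda>n. olver_coeff a b c n * w ^ n) sums (rGamma b * rGamma (c - b) * integral {0..1} (\<lambda>t. ?g t * (1 - w * of_real t) powr (- a)))"
    using nz by (simp add: olver_coeff_def mult_ac)
qed

section \<open>Contiguous relations and existence for all parameters\<close>

lemma olver_coeff_lower_c:
  "olver_coeff a b c n = (c + of_nat n) * olver_coeff a b (c + 1) n"
  using rGamma_plus1[of "c + of_nat n"] by (simp add: olver_coeff_def algebra_simps)

lemma olver_germ_lower_c:
  assumes "olver_germ a b (c + 1) f"
  shows "olver_germ a b c (\<lambda>w. w * deriv f w + c * f w)"
proof -
  have "olver_germ a b c (\<lambda>w. (1 + 0 * w) * (w * deriv f w) + (c + 0 * w) * f w)"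
    by (rule olver_germ_shift[OF assms]) (simp_all add: olver_coeff_lower_c[of a b c] algebra_simps)
  then show ?thesis by simp
qed

text \<open>Raising \<open>a\<close> multiplies the coefficient of index \<open>n\<close> by
  \<open>(a + n) / a\<close>, and multiplication by \<open>n\<close> is the operator
  \<open>w * deriv\<close>.\<close>

lemma olver_germ_raise_a:
  assumes "olver_germ a b c f" and that: "a \<noteq> 0"
  shows "olver_germ (a + 1) b c (\<lambda>w. (w * deriv f w + a * f w) / a)"
proof -
  have coeff: "olver_coeff (a + 1) b c n = (a + of_nat n) / a * olver_coeff a b c n" for n
  proof -
    have "a * pochhammer (a + 1) n = (a + of_nat n) * pochhammer a n"
      using pochhammer_rec[of a n] pochhammer_rec'[of a n] by simp
    then have "pochhammer (a + 1) n = (a + of_nat n) * pochhammer a n / a" using that by (simp add: field_simps)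
    then show ?thesis by (simp add: olver_coeff_def)
  qed
  have "olver_germ (a + 1) b c (\<lambda>w. (1 / a + 0 * w) * (w * deriv f w) + (1 + 0 * w) * f w)"
    by (rule olver_germ_shift[OF assms(1)]) (unfold coeff, use that in \<open>simp_all add: field_simps\<close>)
  then show ?thesis using that by (simp add: field_simps)
qed

text \<open>Solving the contiguous relation for the lower function requires division by
  \<open>c - b - 1\<close>, whence the exclusion of \<open>c = b + 1\<close>.\<close>

lemma olver_germ_lower_b:
  assumes "olver_germ a (b + 1) c f" "c \<noteq> b + 1"
  shows "\<exists>g. olver_germ a b c g"
proof -
  define d where "d = c - (b + 1)"
  have d: "d \<noteq> 0" using assms by (simp add: d_def)
  have "olver_germ a b c (\<lambda>w. (1 / d + (- 1 / d) * w) * (w * deriv f w) + (1 + (- a / d) * w) * f w)"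
  proof (rule olver_germ_shift[OF assms(1)])
    show "olver_coeff a b c 0 = 1 * olver_coeff a (b + 1) c 0" by (simp add: olver_coeff_def)
    fix n
    \<comment> \<open>\<open>X\<close> is the common factor of the three coefficients involved, so
      the relation becomes a polynomial identity in \<open>n\<close>, \<open>a\<close>,
      \<open>b\<close> and \<open>c\<close>.\<close>
    define X where "X = pochhammer a n * pochhammer (b + 1) n * rGamma (c + of_nat (Suc n)) / fact (Suc n)"
    have "olver_coeff a b c (Suc n) = (a + of_nat n) * b * X"
      by (simp add: olver_coeff_def X_def pochhammer_rec[of b] pochhammer_rec'[of a])
    moreover have "olver_coeff a (b + 1) c (Suc n) = (a + of_nat n) * (b + 1 + of_nat n) * X"
      by (simp add: olver_coeff_def X_def pochhammer_rec')
    moreover have "olver_coeff a (b + 1) c n = of_nat (Suc n) * (c + of_nat n) * X"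
    proof -
      have "rGamma (c + of_nat n) = (c + of_nat n) * rGamma (c + of_nat (Suc n))"
        using rGamma_plus1[of "c + of_nat n"] by (simp add: add_ac)
      then show ?thesis by (simp add: olver_coeff_def X_def del: of_nat_Suc)
    qed
    moreover have "d * ((a + of_nat n) * b * X) = (of_nat (Suc n) + d) * ((a + of_nat n) * (b + 1 + of_nat n) * X)
        - (of_nat n + a) * (of_nat (Suc n) * (c + of_nat n) * X)"
      by (simp add: d_def algebra_simps)
    ultimately have "d * olver_coeff a b c (Suc n) = (of_nat (Suc n) + d) * olver_coeff a (b + 1) c (Suc n)
        - (of_nat n + a) * olver_coeff a (b + 1) c n" by simp
    then have "olver_coeff a b c (Suc n) = ((of_nat (Suc n) + d) * olver_coeff a (b + 1) c (Suc n)
        - (of_nat n + a) * olver_coeff a (b + 1) c n) / d"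
      using d by (metis nonzero_mult_div_cancel_left)
    also have "\<dots> = (1 / d * of_nat (Suc n) + 1) * olver_coeff a (b + 1) c (Suc n)
        + (- 1 / d * of_nat n + - a / d) * olver_coeff a (b + 1) c n"
      using d by (simp add: field_simps del: of_nat_Suc)
    finally show "olver_coeff a b c (Suc n) = (1 / d * of_nat (Suc n) + 1) * olver_coeff a (b + 1) c (Suc n)
        + (- 1 / d * of_nat n + - a / d) * olver_coeff a (b + 1) c n" .
  qed
  then show ?thesis by blast
qed

text \<open>Euler's integral covers the case \<open>1 < Re b < Re c - 1\<close>. All other parameters are reached from
  there by lowering first \<open>b\<close>, while \<open>c\<close> is still so large that \<open>c = b + 1\<close> is excluded, and then \<open>c\<close>.\<close>

lemma olver_germ_exists: "\<exists>f. olver_germ a b c f"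
proof -
  obtain M where M: "real M > 2 + \<bar>Re b\<bar>" using reals_Archimedean2 by blast
  obtain N where N: "real N > 2 + real M + \<bar>Re b\<bar> + \<bar>Re c\<bar>" using reals_Archimedean2 by blast
  have "\<exists>f. olver_germ a (b + of_nat (M - k)) (c + of_nat N) f" if "k \<le> M" for k
    using that
  proof (induction k)
    case 0
    have "Re (b + of_nat M) > 1" "Re (c + of_nat N - (b + of_nat M)) > 1" using M N by auto
    from olver_germ_Euler[OF this] show ?case by auto
  next
    case (Suc k)
    then obtain f where f: "olver_germ a (b + of_nat (M - k)) (c + of_nat N) f" by auto
    have "M - k = Suc (M - Suc k)" using Suc by simp
    then have *: "b + of_nat (M - k) = (b + of_nat (M - Suc k)) + 1" by simp
    have "Re (c + of_nat N) \<noteq> Re (b + of_nat (M - k))"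
    proof -
      have "real (M - k) \<le> real M" by simp
      then show ?thesis using N by (simp del: of_nat_diff) 
    qed
    then have "c + of_nat N \<noteq> b + of_nat (M - Suc k) + 1" unfolding * by metis
    with f show ?case unfolding * by (intro olver_germ_lower_b)
  qed
  from this[of M] have "\<exists>f. olver_germ a b (c + of_nat N) f" by simp
  moreover have "\<exists>f. olver_germ a b (c + of_nat N) f \<Longrightarrow> \<exists>f. olver_germ a b c f"
  proof (induction N)
    case (Suc N)
    then show ?case using olver_germ_lower_c[of a b "c + of_nat N"] by (auto simp: add_ac)
  qed simp
  ultimately show ?thesis by blast
qed

lemma olver_germ_olver2F1: "olver_germ a b c (olver2F1 a b c)"
proof -
  obtain f where f: "olver_germ a b c f" using olver_germ_exists by blast
  then show ?thesis using olver_germ_eq[OF f] by (rule olver_germ_cong)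
qed

lemma holomorphic_olver2F1: "olver2F1 a b c holomorphic_on slit"
  using olver_germ_olver2F1 by (simp add: olver_germ_def)

lemma olver2F1_sums:
  "norm w < 1 \<Longrightarrow> (\<lambda>n. olver_coeff a b c n * w ^ n) sums olver2F1 a b c w"
  using olver_germ_olver2F1[of a b c] by (simp add: olver_germ_def)

lemma olver2F1_commute: "olver2F1 a b c = olver2F1 b a c"
  by (simp add: olver2F1_def mult_ac)

text \<open>Both branches of the definition coincide on \<open>slit\<close>: away from the poles of
  \<open>Gamma\<close>, the factor \<open>rGamma (c + n)\<close> is
  \<open>rGamma c / pochhammer c n\<close>. From here on \<open>olver2F1\<close> alone has to be
  considered.\<close>

lemma hyp2F1_over_Gamma_eq:
  assumes "w \<in> slit"
  shows "hyp2F1_over_Gamma a b c w = olver2F1 a b c w"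
proof (cases "c \<in> \<int>\<^sub>\<le>\<^sub>0")
  case False
  then have nz: "rGamma c \<noteq> 0" "\<And>n. pochhammer c n \<noteq> 0" by (auto simp: rGamma_eq_zero_iff pochhammer_eq_0_iff)
  have "hyp2F1 a b c w = Gamma c * olver2F1 a b c w"
    unfolding hyp2F1_def slit_def[symmetric]
  proof (rule continuation_eqI[OF open_slit connected_slit ball_subset_slit _ zero_islimpt_ball _ _ assms])
    show "(\<lambda>w. Gamma c * olver2F1 a b c w) holomorphic_on slit"
      by (intro holomorphic_intros holomorphic_olver2F1)
    fix z :: complex assume "z \<in> ball 0 1"
    then have "(\<lambda>n. Gamma c * (olver_coeff a b c n * z ^ n)) sums (Gamma c * olver2F1 a b c z)"
      by (intro sums_mult olver2F1_sums) auto
    also have "(\<lambda>n. Gamma c * (olver_coeff a b c n * z ^ n)) =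
        (\<lambda>n. pochhammer a n * pochhammer b n / pochhammer c n * z ^ n / fact n)"
    proof
      fix n
      have "Gamma c * rGamma (c + of_nat n) = 1 / pochhammer c n"
        unfolding Gamma_def using nz pochhammer_rGamma[of c n] by (auto simp: field_simps)
      then have "pochhammer a n * pochhammer b n * (Gamma c * rGamma (c + of_nat n)) * z ^ n / fact n =
          pochhammer a n * pochhammer b n / pochhammer c n * z ^ n / fact n" by simp
      then show "Gamma c * (olver_coeff a b c n * z ^ n) = pochhammer a n * pochhammer b n / pochhammer c n * z ^ n / fact n"
        unfolding olver_coeff_def by (simp add: mult_ac)
    qed
    finally show "Gamma c * olver2F1 a b c z = (\<Sum>n. pochhammer a n * pochhammer b n / pochhammer c n * z ^ n / fact n)"
      by (simp add: sums_iff)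
  qed (simp add: slit_iff')
  moreover have "Gamma c \<noteq> 0" using False by (simp add: Gamma_eq_zero_iff)
  ultimately show ?thesis using False by (simp add: hyp2F1_over_Gamma_def)
qed (simp add: hyp2F1_over_Gamma_def)

section \<open>Integral representation of the function of the second kind\<close>

lemma continuous_on_gegenbauer_weight:
  assumes "Re \<nu> > 0"
  shows "continuous_on {-1..1} (\<lambda>t::real. complex_of_real (1 - t\<^sup>2) powr \<nu>)"
  using assms by (intro continuous_intros) (auto simp: power_le_one_iff abs_square_le_1 abs_le_iff)

text \<open>The moments of the weight for Gegenbauer polynomials of parameter
  \<open>\<nu> + 1 / 2\<close>.\<close>

definition gegenbauer_moment :: "complex \<Rightarrow> nat \<Rightarrow> complex" where
  "gegenbauer_moment \<nu> k = integral {-1..1} (\<lambda>t::real. of_real (1 - t\<^sup>2) powr \<nu> * of_real t ^ k)"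

lemma has_integral_gegenbauer_moment:
  assumes "Re \<nu> > 0"
  shows "((\<lambda>t::real. of_real (1 - t\<^sup>2) powr \<nu> * of_real t ^ k) has_integral gegenbauer_moment \<nu> k) {-1..1}"
  unfolding gegenbauer_moment_def
  by (intro integrable_integral integrable_continuous_real continuous_intros continuous_on_gegenbauer_weight assms)

lemma gegenbauer_moment_odd:
  assumes "Re \<nu> > 0" "odd k"
  shows "gegenbauer_moment \<nu> k = 0"
proof -
  have "((\<lambda>t::real. of_real (1 - (- t)\<^sup>2) powr \<nu> * of_real (- t) ^ k) has_integral gegenbauer_moment \<nu> k) {-1..1}"
    using has_integral_reflect_real[of "\<lambda>t::real. of_real (1 - t\<^sup>2) powr \<nu> * of_real t ^ k" _ 1 "-1"]
      has_integral_gegenbauer_moment[OF assms(1), of k] by simp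
  moreover have "((\<lambda>t::real. - (of_real (1 - t\<^sup>2) powr \<nu> * of_real t ^ k)) has_integral - gegenbauer_moment \<nu> k) {-1..1}"
    by (intro has_integral_neg has_integral_gegenbauer_moment assms)
  ultimately have "gegenbauer_moment \<nu> k = - gegenbauer_moment \<nu> k"
    using assms(2) by (simp add: has_integral_unique)
  then show ?thesis by simp
qed

text \<open>The substitution \<open>t = 2 * u - 1\<close> gives a beta integral with equal
  parameters, whose \<open>rGamma (2 * \<nu> + 2)\<close> is split by Legendre's duplication
  formula.\<close>

lemma gegenbauer_moment_0:
  assumes "Re \<nu> > 0"
  shows "gegenbauer_moment \<nu> 0 = of_real (sqrt pi) * Gamma (\<nu> + 1) * rGamma (\<nu> + 3 / 2)"
proof -
  let ?f = "\<lambda>t::real. complex_of_real (1 - t\<^sup>2) powr \<nu>"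
  have "((\<lambda>u. ?f (2 *\<^sub>R u + (- 1))) has_integral (gegenbauer_moment \<nu> 0 /\<^sub>R 2 ^ DIM(real)))
      (cbox ((- 1 - (- 1)) /\<^sub>R 2) ((1 - (- 1)) /\<^sub>R 2))"
    using has_integral_gegenbauer_moment[OF assms, of 0] by (intro has_integral_affinity') auto
  then have "((\<lambda>u. ?f (2 * u - 1)) has_integral (gegenbauer_moment \<nu> 0 / 2)) {0..1}"
    by (simp add: scaleR_conv_of_real)
  moreover have "((\<lambda>u. ?f (2 * u - 1)) has_integral (4 powr \<nu> * beta_integral (\<nu> + 1) (\<nu> + 1))) {0..1}"
  proof (rule has_integral_eq[rotated])
    show "((\<lambda>t::real. 4 powr \<nu> * (of_real t powr (\<nu> + 1 - 1) * of_real (1 - t) powr (\<nu> + 1 - 1)))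
        has_integral (4 powr \<nu> * beta_integral (\<nu> + 1) (\<nu> + 1))) {0..1}"
      using assms by (intro has_integral_mult_right has_integral_beta) auto
    fix t :: real assume t: "t \<in> {0..1}"
    have "complex_of_real (1 - (2 * t - 1)\<^sup>2) = 4 * (of_real t * of_real (1 - t))"
      by (simp add: power2_eq_square algebra_simps)
    then have "?f (2 * t - 1) = (4 * (of_real t * of_real (1 - t))) powr \<nu>" by simp
    also have "\<dots> = 4 powr \<nu> * (of_real t powr \<nu> * of_real (1 - t) powr \<nu>)"
      using t by (subst powr_times_real_left, simp, simp, subst powr_times_real_left) auto
    finally show "4 powr \<nu> * (complex_of_real t powr (\<nu> + 1 - 1) * of_real (1 - t) powr (\<nu> + 1 - 1)) = ?f (2 * t - 1)"
      by simp
  qed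
  ultimately have "gegenbauer_moment \<nu> 0 / 2 = 4 powr \<nu> * beta_integral (\<nu> + 1) (\<nu> + 1)"
    by (rule has_integral_unique)
  also have "beta_integral (\<nu> + 1) (\<nu> + 1) = Gamma (\<nu> + 1) * Gamma (\<nu> + 1) * rGamma (2 * \<nu> + 2)"
    using assms by (subst beta_integral_eq) (auto simp: algebra_simps)
  finally have m: "gegenbauer_moment \<nu> 0 = 2 * 4 powr \<nu> * Gamma (\<nu> + 1) * Gamma (\<nu> + 1) * rGamma (2 * \<nu> + 2)"
    by simp
  have nz: "\<nu> + 1 \<notin> \<int>\<^sub>\<le>\<^sub>0" "\<nu> + 3/2 \<notin> \<int>\<^sub>\<le>\<^sub>0" "2 * \<nu> + 2 \<notin> \<int>\<^sub>\<le>\<^sub>0"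
    using assms by (auto intro!: Re_pos_not_nonpos_Int)
  have "Gamma (\<nu> + 1) * Gamma (\<nu> + 3 / 2) = exp ((1 - 2 * (\<nu> + 1)) * of_real (ln 2)) * of_real (sqrt pi) * Gamma (2 * \<nu> + 2)"
    using Gamma_legendre_duplication[of "\<nu> + 1"] nz by (simp add: algebra_simps)
  \<comment> \<open>The powers of 2 from the substitution cancel the one in the duplication
    formula.\<close>
  moreover have "2 * 4 powr \<nu> * exp ((1 - 2 * (\<nu> + 1)) * of_real (ln 2)) = 1"
  proof -
    have l2: "Ln 2 = of_real (ln 2)" using Ln_of_real[of 2] by simp
    have "Ln 4 = of_real (ln (2 ^ 2))" using Ln_of_real[of 4] by simp
    also have "\<dots> = 2 * of_real (ln 2)" by (subst ln_realpow) auto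
    finally have "2 * 4 powr \<nu> * exp ((1 - 2 * (\<nu> + 1)) * of_real (ln 2)) =
        exp (Ln 2) * (exp (\<nu> * (2 * of_real (ln 2))) * exp ((1 - 2 * (\<nu> + 1)) * of_real (ln 2)))"
      by (simp add: powr_def)
    also have "\<dots> = exp (of_real (ln 2) + (\<nu> * (2 * of_real (ln 2)) + (1 - 2 * (\<nu> + 1)) * of_real (ln 2)))"
      by (simp only: exp_add l2)
    also have "\<dots> = 1" by (simp add: algebra_simps)
    finally show ?thesis .
  qed
  moreover have "Gamma (\<nu> + 3 / 2) * rGamma (\<nu> + 3 / 2) = 1" "Gamma (2 * \<nu> + 2) * rGamma (2 * \<nu> + 2) = 1"
    using nz by (auto simp: Gamma_def rGamma_eq_zero_iff)
  moreover have "X * G1 * G1 * R2 = P * G1 * R3"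
    if "G1 * G3 = E * P * G2" "X * E = 1" "G3 * R3 = 1" "G2 * R2 = 1" for X G1 G2 G3 R2 R3 E P :: complex
  proof -
    have "X * G1 * G1 * R2 = X * G1 * R2 * (G1 * G3) * R3" using that(3) by (simp add: mult_ac)
    also have "\<dots> = (X * E) * (G2 * R2) * (P * G1 * R3)" by (simp only: that(1) mult_ac)
    finally show ?thesis using that by simp
  qed
  ultimately show ?thesis unfolding m by blast
qed

text \<open>Integrating the derivative of \<open>t ^ (k + 1) * (1 - t ^ 2) powr (\<nu> + 1)\<close>
  gives 0, since this function vanishes at both ends.\<close>

lemma gegenbauer_moment_step:
  assumes "Re \<nu> > 0"
  shows "(of_nat k + 1) * gegenbauer_moment \<nu> k = (of_nat k + 2 * \<nu> + 3) * gegenbauer_moment \<nu> (k + 2)"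
proof -
  let ?F = "\<lambda>t::real. complex_of_real t ^ Suc k * of_real (1 - t\<^sup>2) powr (\<nu> + 1)"
  have "((\<lambda>t::real. (of_nat k + 1) * (of_real (1 - t\<^sup>2) powr \<nu> * of_real t ^ k)
      - (of_nat k + 2 * \<nu> + 3) * (of_real (1 - t\<^sup>2) powr \<nu> * of_real t ^ (k + 2))) has_integral (?F 1 - ?F (- 1))) {-1..1}"
  proof (rule fundamental_theorem_of_calculus_interior)
    show "continuous_on {-1..1} ?F"
      using assms by (intro continuous_intros continuous_on_gegenbauer_weight) auto
  next
    fix t :: real assume t: "t \<in> {-1<..<1}"
    let ?u = "complex_of_real t"
    have pos: "1 - t\<^sup>2 > 0" using t by (simp add: abs_square_less_1 abs_less_iff)
    then have npos: "1 - ?u\<^sup>2 \<notin> \<real>\<^sub>\<le>\<^sub>0" by (simp add: complex_nonpos_Reals_iff flip: of_real_power)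
    have nz: "1 - ?u\<^sup>2 \<noteq> 0" using npos by force
    have D: "((\<lambda>z. z ^ Suc k * (1 - z\<^sup>2) powr (\<nu> + 1)) has_field_derivative
        (of_nat (Suc k) * ?u ^ k * (1 - ?u\<^sup>2) powr (\<nu> + 1) + ?u ^ Suc k * ((\<nu> + 1) * (1 - ?u\<^sup>2) powr \<nu> * (- 2 * ?u)))) (at ?u)"
    proof -
      have "((\<lambda>z. (1 - z\<^sup>2) powr (\<nu> + 1)) has_field_derivative
          ((\<nu> + 1) * (1 - ?u\<^sup>2) powr \<nu> * (- 2 * ?u))) (at ?u)"
        using npos by (auto intro!: derivative_eq_intros)
      from DERIV_mult[OF DERIV_power[OF DERIV_ident, of "Suc k"] this]
      show ?thesis by (rule DERIV_cong) (simp add: algebra_simps)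
    qed
    have p: "(1 - ?u\<^sup>2) powr (\<nu> + 1) = (1 - ?u\<^sup>2) * (1 - ?u\<^sup>2) powr \<nu>"
      using powr_minus_one_mult[OF nz, of "\<nu> + 1"] by simp
    have eq: "of_nat (Suc k) * ?u ^ k * (1 - ?u\<^sup>2) powr (\<nu> + 1) + ?u ^ Suc k * ((\<nu> + 1) * (1 - ?u\<^sup>2) powr \<nu> * (- 2 * ?u))
       = (of_nat k + 1) * (of_real (1 - t\<^sup>2) powr \<nu> * ?u ^ k) - (of_nat k + 2 * \<nu> + 3) * (of_real (1 - t\<^sup>2) powr \<nu> * ?u ^ (k + 2))"
    proof -
      have o: "complex_of_real (1 - t\<^sup>2) powr \<nu> = (1 - ?u\<^sup>2) powr \<nu>" by simp
      show ?thesis unfolding o p by (simp add: power2_eq_square algebra_simps)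
    qed
    show "(?F has_vector_derivative ((of_nat k + 1) * (of_real (1 - t\<^sup>2) powr \<nu> * of_real t ^ k)
      - (of_nat k + 2 * \<nu> + 3) * (of_real (1 - t\<^sup>2) powr \<nu> * of_real t ^ (k + 2)))) (at t)"
      using has_vector_derivative_real_field[OF D] eq by simp
  qed auto
  moreover have "((\<lambda>t::real. (of_nat k + 1) * (of_real (1 - t\<^sup>2) powr \<nu> * of_real t ^ k)
      - (of_nat k + 2 * \<nu> + 3) * (of_real (1 - t\<^sup>2) powr \<nu> * of_real t ^ (k + 2))) has_integral
      ((of_nat k + 1) * gegenbauer_moment \<nu> k - (of_nat k + 2 * \<nu> + 3) * gegenbauer_moment \<nu> (k + 2))) {-1..1}"
    using assms by (intro has_integral_diff has_integral_mult_right has_integral_gegenbauer_moment)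
  moreover have "?F 1 - ?F (- 1) = 0" by simp
  ultimately show ?thesis by (metis (no_types, lifting) has_integral_unique right_minus_eq)
qed

lemma gegenbauer_moment_even:
  assumes "Re \<nu> > 0"
  shows "gegenbauer_moment \<nu> (2 * k) =
      of_real (sqrt pi) * Gamma (\<nu> + 1) * pochhammer (1 / 2) k * rGamma (\<nu> + 3 / 2 + of_nat k)"
proof (induction k)
  case 0
  then show ?case by (simp add: gegenbauer_moment_0 assms)
next
  case (Suc k)
  let ?d = "\<nu> + 3 / 2 + of_nat k"
  have d: "?d \<noteq> 0" using assms by (auto simp: complex_eq_iff)
  have "2 * ((1 / 2 + of_nat k) * gegenbauer_moment \<nu> (2 * k)) = 2 * (?d * gegenbauer_moment \<nu> (2 * Suc k))"
    using gegenbauer_moment_step[OF assms, of "2 * k"] by (simp add: algebra_simps)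
  then have "?d * gegenbauer_moment \<nu> (2 * Suc k) = (1 / 2 + of_nat k) * gegenbauer_moment \<nu> (2 * k)"
    by simp
  also have "rGamma ?d = ?d * rGamma (\<nu> + 3 / 2 + of_nat (Suc k))"
    using rGamma_plus1[of ?d] by (simp add: add_ac)
  then have "(1 / 2 + of_nat k) * gegenbauer_moment \<nu> (2 * k) =
      ?d * (of_real (sqrt pi) * Gamma (\<nu> + 1) * pochhammer (1 / 2) (Suc k) * rGamma (\<nu> + 3 / 2 + of_nat (Suc k)))"
    unfolding Suc by (simp add: pochhammer_rec')
  finally show ?case using d by simp
qed

text \<open>With \<open>s = \<nu> + \<mu> + 1\<close>, these are \<open>Q(z)\<close> and the Ferrers function \<open>P(-z)\<close>, without constants and
  without the power \<open>\<mu> / 2\<close> of \<open>z\<^sup>2 - 1\<close> and \<open>1 - z\<^sup>2\<close> respectively. Taking \<open>s\<close> instead of \<open>\<mu>\<close> as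
  parameter turns the recurrences into independent shifts of \<open>s\<close> and of \<open>\<nu>\<close>.\<close>

definition legendre_I :: "complex \<Rightarrow> complex \<Rightarrow> complex \<Rightarrow> complex" where
  "legendre_I \<nu> s z = z powr (- s) * olver2F1 ((s + 1) / 2) (s / 2) (\<nu> + 3 / 2) (1 / z\<^sup>2)"

definition legendre_K :: "complex \<Rightarrow> complex \<Rightarrow> complex \<Rightarrow> complex" where
  "legendre_K \<nu> s z = (1 + z) powr (\<nu> + 1 - s) * olver2F1 (- \<nu>) (\<nu> + 1) (\<nu> + 2 - s) ((1 + z) / 2)"

text \<open>A value \<open>1 / z\<^sup>2\<close> in \<open>[1, oo)\<close> forces \<open>z\<close>
  to be real. Hence \<open>legendre_I\<close> makes sense on both open half planes, including points
  with \<open>norm z < 1\<close>, where the series in \<open>1 / z\<^sup>2\<close> is of no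
  use.\<close>

lemma inverse_square_in_slit:
  assumes "Im z \<noteq> 0"
  shows "1 / z\<^sup>2 \<in> slit"
proof (rule ccontr)
  assume "1 / z\<^sup>2 \<notin> slit"
  then obtain r where r: "r \<ge> 1" "1 / z\<^sup>2 = of_real r" by (auto simp: slit_def)
  then have "z\<^sup>2 = of_real (1 / r)" by (metis inverse_eq_divide inverse_inverse_eq of_real_inverse)
  also have "\<dots> = (of_real (sqrt (1 / r)))\<^sup>2" using r by (simp flip: of_real_power)
  finally have "z = of_real (sqrt (1 / r)) \<or> z = - of_real (sqrt (1 / r))" by (simp add: power2_eq_iff)
  then show False using assms by (metis Im_complex_of_real neg_equal_0_iff_equal uminus_complex.sel(2))
qed

section \<open>Geometry of \<open>D1\<close> and holomorphy of the building blocks\<close>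

lemma D1_iff: "z \<in> D1 \<longleftrightarrow> Im z \<noteq> 0 \<or> \<bar>Re z\<bar> < 1"
proof -
  have "z \<in> of_real ` ({..-1} \<union> {1..}) \<longleftrightarrow> Im z = 0 \<and> \<bar>Re z\<bar> \<ge> 1"
  proof
    assume "Im z = 0 \<and> \<bar>Re z\<bar> \<ge> 1"
    then have "z = of_real (Re z)" "Re z \<in> {..-1} \<union> {1..}" by (auto simp: complex_eq_iff)
    then show "z \<in> of_real ` ({..-1} \<union> {1..})" by blast
  qed auto
  then show ?thesis by (auto simp: D1_def not_le)
qed

lemma D1_half_plane_maps:
  assumes "z \<in> D1"
  shows "(1 + z) / 2 \<in> slit" "(1 - z) / 2 \<in> slit" "1 + z \<notin> \<real>\<^sub>\<le>\<^sub>0" "1 - z \<notin> \<real>\<^sub>\<le>\<^sub>0" "- z \<in> D1"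
  using assms by (auto simp: D1_iff slit_iff' complex_nonpos_Reals_iff)

lemma open_D1: "open D1"
proof -
  have "D1 = (\<lambda>z. 1 - z) -` (- \<real>\<^sub>\<le>\<^sub>0) \<inter> (\<lambda>z. 1 + z) -` (- \<real>\<^sub>\<le>\<^sub>0)"
    by (auto simp: D1_iff complex_nonpos_Reals_iff)
  moreover have "open ((\<lambda>z::complex. 1 - z) -` (- \<real>\<^sub>\<le>\<^sub>0) \<inter> (\<lambda>z. 1 + z) -` (- \<real>\<^sub>\<le>\<^sub>0))"
    by (intro open_Int continuous_open_vimage continuous_intros) auto
  ultimately show ?thesis by simp
qed

lemma connected_D1: "connected D1"
proof (rule starlike_connected_mult)
  fix z t assume "z \<in> D1" "0 \<le> t" "t \<le> (1::real)"
  moreover have "\<bar>Re z * t\<bar> \<le> \<bar>Re z\<bar>" if "0 \<le> t" "t \<le> 1"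
    using that by (simp add: abs_mult mult_left_le)
  ultimately show "z * of_real t \<in> D1" by (auto simp: D1_iff)
qed (simp add: D1_iff)

lemma holomorphic_legendre_I: "legendre_I \<nu> s holomorphic_on {z. Im z \<noteq> 0}"
proof -
  have "(olver2F1 a b c \<circ> (\<lambda>z. 1 / z\<^sup>2)) holomorphic_on {z. Im z \<noteq> 0}" for a b c
    by (rule holomorphic_on_compose_gen[OF _ holomorphic_olver2F1])
       (auto intro!: holomorphic_intros simp: inverse_square_in_slit)
  then show ?thesis
    unfolding legendre_I_def o_def
    by (intro holomorphic_intros) (auto simp: complex_nonpos_Reals_iff)
qed

lemma holomorphic_olver2F1_half:
  "(\<lambda>z. olver2F1 a b c ((1 + z) / 2)) holomorphic_on D1"
  "(\<lambda>z. olver2F1 a b c ((1 - z) / 2)) holomorphic_on D1"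
proof -
  have "(olver2F1 a b c \<circ> (\<lambda>z. (1 + z) / 2)) holomorphic_on D1" "(olver2F1 a b c \<circ> (\<lambda>z. (1 - z) / 2)) holomorphic_on D1"
    by (rule holomorphic_on_compose_gen[OF _ holomorphic_olver2F1];
        auto intro!: holomorphic_intros simp: D1_half_plane_maps)+
  then show "(\<lambda>z. olver2F1 a b c ((1 + z) / 2)) holomorphic_on D1"
    "(\<lambda>z. olver2F1 a b c ((1 - z) / 2)) holomorphic_on D1" by (simp_all add: o_def)
qed

lemma holomorphic_legendre_K: "legendre_K \<nu> s holomorphic_on D1"
  unfolding legendre_K_def
  by (intro holomorphic_intros holomorphic_olver2F1_half) (auto simp: D1_half_plane_maps)

text \<open>The binomial series of \<open>(1 - t / z) powr (- s)\<close> converges because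
  \<open>norm z > 1\<close>, and its odd terms integrate to 0. In the even terms, the duplication of
  \<open>pochhammer s (2 * k)\<close> produces the two upper parameters \<open>s / 2\<close> and
  \<open>(s + 1) / 2\<close>.\<close>

lemma legendre_I_integral:
  assumes \<nu>: "Re \<nu> > 0" and z: "norm z > 1" "Im z > 0"
  shows "integral {-1..1} (\<lambda>t. of_real (1 - t\<^sup>2) powr \<nu> * (z - of_real t) powr (- s))
    = of_real (sqrt pi) * Gamma (\<nu> + 1) * legendre_I \<nu> s z"
proof -
  let ?g = "\<lambda>t::real. complex_of_real (1 - t\<^sup>2) powr \<nu>" and ?w = "1 / z"
  have nw: "norm ?w < 1" using z by (simp add: norm_divide divide_less_eq)
  let ?T = "\<lambda>n. pochhammer s n / fact n * ?w ^ n * gegenbauer_moment \<nu> n"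
  have "?T sums integral {-1..1} (\<lambda>t. ?g t * (\<Sum>n. pochhammer s n / fact n * (?w * of_real t) ^ n))"
    unfolding gegenbauer_moment_def
    by (rule integral_powser_sums[OF continuous_on_gegenbauer_weight[OF \<nu>] _ _ conv_radius_pochhammer nw]) auto
  also have "integral {-1..1} (\<lambda>t. ?g t * (\<Sum>n. pochhammer s n / fact n * (?w * of_real t) ^ n))
      = integral {-1..1} (\<lambda>t. z powr s * (?g t * (z - of_real t) powr (- s)))"
  proof (rule integral_cong)
    fix t :: real assume t: "t \<in> {-1..1}"
    have "norm (?w * of_real t) \<le> norm ?w" unfolding norm_mult using t by (intro mult_left_le) auto
    with nw have n1: "norm (?w * of_real t) < 1" by linarith
    have "(\<Sum>n. pochhammer s n / fact n * (?w * of_real t) ^ n) = (1 - ?w * of_real t) powr (- s)"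
      using powr_one_minus_sums[OF n1, of s] by (simp add: sums_iff)
    also have "\<dots> = z powr s * (z - of_real t) powr (- s)"
    proof -
      let ?q = "1 - ?w * of_real t"
      have Req: "Re ?q > 0" using n1 complex_Re_le_cmod[of "?w * of_real t"] by (simp del: Re_divide)
      then have q0: "?q \<noteq> 0" by (auto simp del: Re_divide)
      have z0: "z \<noteq> 0" using z by auto
      have zt: "z * ?q = z - of_real t" using z0 by (simp add: algebra_simps)
      \<comment> \<open>A correction by \<open>2 * pi\<close> is impossible: \<open>z\<close> and
        \<open>z * ?q = z - t\<close> both lie in the upper half plane and the argument of
        \<open>?q\<close> is below \<open>pi / 2\<close> in modulus, so the corrected argument would
        be negative.\<close>
      have "Ln (z * ?q) = Ln z + Ln ?q"
      proof -
        have a: "\<bar>Im (Ln ?q)\<bar> < pi / 2" using Req by (rule Re_Ln_pos_lt_imp)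
        have b: "0 < Im (Ln z)" "Im (Ln z) < pi" using z z0 Im_Ln_pos_lt_imp[of z] by auto
        have "z * ?q \<noteq> 0" using z0 q0 by simp
        have c: "0 < Im (Ln (z * ?q))" unfolding zt using z Im_Ln_pos_lt_imp[of "z - of_real t"] by simp
        show ?thesis
        proof (cases "Im (Ln z + Ln ?q) > pi")
          case True
          then have "Ln (z * ?q) = Ln z + Ln ?q - \<i> * of_real (2 * pi)"
            using a b Ln_times[OF z0 q0] by auto
          then have "Im (Ln (z * ?q)) = Im (Ln z) + Im (Ln ?q) - 2 * pi" by simp
          with a b c show ?thesis by linarith
        next
          case False
          then show ?thesis using a b Ln_times[OF z0 q0] by auto
        qed
      qed
      moreover have "z * ?q \<noteq> 0" using z0 q0 by simp
      ultimately have "(z * ?q) powr (- s) = z powr (- s) * ?q powr (- s)"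
        unfolding powr_def by (simp only: z0 q0 if_False ring_distribs exp_add)
      then have "(z - of_real t) powr (- s) = z powr (- s) * ?q powr (- s)" unfolding zt .
      then show ?thesis using z0 by (simp add: powr_minus)
    qed
    finally show "?g t * (\<Sum>n. pochhammer s n / fact n * (?w * of_real t) ^ n) = z powr s * (?g t * (z - of_real t) powr (- s))"
      by simp
  qed
  also have "\<dots> = z powr s * integral {-1..1} (\<lambda>t. ?g t * (z - of_real t) powr (- s))"
    by simp
  finally have "(\<lambda>k. ?T (2 * k)) sums (z powr s * integral {-1..1} (\<lambda>t. ?g t * (z - of_real t) powr (- s)))"
    by (subst sums_mono_reindex[where g = "\<lambda>k. 2 * k" and f = ?T])
       (auto simp: strict_mono_def gegenbauer_moment_odd[OF \<nu>] elim!: oddE intro!: gegenbauer_moment_odd[OF \<nu>])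
  moreover have "(\<lambda>k. ?T (2 * k)) = (\<lambda>k. of_real (sqrt pi) * Gamma (\<nu> + 1) *
      (olver_coeff ((s + 1) / 2) (s / 2) (\<nu> + 3 / 2) k * (1 / z\<^sup>2) ^ k))"
  proof
    fix k
    have p: "pochhammer s (2 * k) = of_nat (2 ^ (2 * k)) * pochhammer (s / 2) k * pochhammer ((s + 1) / 2) k"
      using pochhammer_double[of "s / 2" k] by (simp add: add_divide_distrib)
    \<comment> \<open>This factor occurs in the moment and, by duplication, in
      \<open>fact (2 * k)\<close>; it can be cancelled because it is nonzero.\<close>
    have h: "pochhammer (1 / 2 :: complex) k \<noteq> 0"
      by (auto simp: pochhammer_eq_0_iff dest: arg_cong[of _ _ Re])
    have "(1 / z) ^ (2 * k) = (1 / z\<^sup>2) ^ k" by (simp add: power_mult power_divide)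
    then show "?T (2 * k) = of_real (sqrt pi) * Gamma (\<nu> + 1) *
        (olver_coeff ((s + 1) / 2) (s / 2) (\<nu> + 3 / 2) k * (1 / z\<^sup>2) ^ k)"
      using h unfolding p gegenbauer_moment_even[OF \<nu>] fact_double olver_coeff_def by simp
  qed
  moreover have "(\<lambda>k. of_real (sqrt pi) * Gamma (\<nu> + 1) *
      (olver_coeff ((s + 1) / 2) (s / 2) (\<nu> + 3 / 2) k * (1 / z\<^sup>2) ^ k)) sums
      (of_real (sqrt pi) * Gamma (\<nu> + 1) * olver2F1 ((s + 1) / 2) (s / 2) (\<nu> + 3 / 2) (1 / z\<^sup>2))"
  proof (intro sums_mult olver2F1_sums)
    have "1 < norm z ^ 2" using z(1) by (rule one_less_power) simp
    then show "norm (1 / z\<^sup>2) < 1" unfolding norm_divide norm_power by (subst divide_less_eq_1_pos) auto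
  qed
  ultimately have "z powr s * integral {-1..1} (\<lambda>t. ?g t * (z - of_real t) powr (- s)) =
      of_real (sqrt pi) * Gamma (\<nu> + 1) * olver2F1 ((s + 1) / 2) (s / 2) (\<nu> + 3 / 2) (1 / z\<^sup>2)"
    by (simp add: sums_unique2)
  moreover have "z \<noteq> 0" using z by auto
  then have "z powr s * z powr (- s) = 1" by (simp add: powr_minus)
  moreover have "x = b * (p' * c)" if "p * x = b * c" "p * p' = 1" for x b c p p' :: complex
  proof -
    have "x = p' * (p * x)" using that(2) by (simp add: mult_ac flip: mult.assoc)
    then show ?thesis using that(1) by (simp add: mult_ac)
  qed
  ultimately show ?thesis unfolding legendre_I_def by blast
qed

section \<open>Connection formula for large parameters\<close>

text \<open>Euler's integral for the hypergeometric factor of \<open>legendre_K\<close>, stripped of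
  its Gamma factors: here \<open>b - 1 = \<nu>\<close>, \<open>c - b - 1 = - s\<close> and
  \<open>- a = \<nu>\<close>.\<close>

definition legendre_J :: "complex \<Rightarrow> complex \<Rightarrow> complex \<Rightarrow> complex" where
  "legendre_J \<nu> s z = integral {0..1} (\<lambda>t. of_real t powr \<nu> * of_real (1 - t) powr (- s)
     * (1 - (1 + z) / 2 * of_real t) powr \<nu>)"

lemma legendre_K_Euler:
  assumes "Re \<nu> > 0" "Re s < 0" "z \<in> D1"
  shows "(1 + z) powr (\<nu> + 1 - s) * legendre_J \<nu> s z = Gamma (\<nu> + 1) * Gamma (1 - s) * legendre_K \<nu> s z"
proof -
  have "olver_germ (- \<nu>) (\<nu> + 1) (\<nu> + 2 - s) (\<lambda>w. rGamma (\<nu> + 1) * rGamma (\<nu> + 2 - s - (\<nu> + 1)) *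
      integral {0..1} (\<lambda>t. of_real t powr (\<nu> + 1 - 1) * of_real (1 - t) powr (\<nu> + 2 - s - (\<nu> + 1) - 1) * (1 - w * of_real t) powr (- (- \<nu>))))"
    by (rule olver_germ_Euler) (use assms in auto)
  from olver_germ_eq[OF this D1_half_plane_maps(1)[OF assms(3)]]
  have "olver2F1 (- \<nu>) (\<nu> + 1) (\<nu> + 2 - s) ((1 + z) / 2) = rGamma (\<nu> + 1) * rGamma (1 - s) * legendre_J \<nu> s z"
    by (simp add: legendre_J_def algebra_simps)
  moreover have "Gamma (\<nu> + 1) * rGamma (\<nu> + 1) = 1" "Gamma (1 - s) * rGamma (1 - s) = 1"
    using assms Re_pos_not_nonpos_Int[of "\<nu> + 1"] Re_pos_not_nonpos_Int[of "1 - s"]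
    by (auto simp: Gamma_def rGamma_eq_zero_iff)
  moreover have "p * J = G * H * (p * (g * h * J))" if "G * g = 1" "H * h = 1" for p J G g H h :: complex
  proof -
    have "G * H * (p * (g * h * J)) = (G * g) * (H * h) * (p * J)" by (simp only: mult_ac)
    then show ?thesis using that by simp
  qed
  ultimately show ?thesis unfolding legendre_K_def by metis
qed

text \<open>In the upper half plane the principal arguments of \<open>z\<close> and
  \<open>- z\<close> differ by exactly \<open>pi\<close>; this is the source of every phase factor
  below.\<close>

lemma powr_uminus_upper:
  assumes "Im z > 0"
  shows "z powr a = exp (\<i> * of_real pi * a) * (- z) powr a"
proof -
  have "Ln (- (- z)) = Ln (- z) + \<i> * of_real pi"
    using assms by (subst Ln_minus) auto
  then show ?thesis using assms by (auto simp: powr_def exp_add algebra_simps)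
qed

text \<open>Serves both slanted sides of the triangle: the side at 1 becomes one starting at
  \<open>-1\<close> after reflection of both \<open>z\<close> and the variable, with the resulting
  phase in \<open>C\<close>. The factor \<open>b - a = 1 + z\<close> raises the exponent
  \<open>\<nu> - s\<close> to \<open>\<nu> + 1 - s\<close>.\<close>

lemma contour_integral_side:
  assumes z: "Im z \<noteq> 0" and ba: "b - a = 1 + z"
    and f: "\<And>t. t \<in> {0..1} \<Longrightarrow> f (linepath a b t) = C * ((1 + z) powr (\<nu> - s) *
        (of_real t powr \<nu> * of_real (1 - t) powr (- s) * (1 - (1 + z) / 2 * of_real t) powr \<nu>))"
    and \<nu>: "Re \<nu> > 0" "Re s < 0"
  shows "(f has_contour_integral (C * ((1 + z) powr (\<nu> + 1 - s) * legendre_J \<nu> s z))) (linepath a b)"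
  unfolding has_contour_integral_linepath
proof (rule has_integral_eq[rotated])
  let ?g = "\<lambda>t::real. of_real t powr \<nu> * of_real (1 - t) powr (- s) * (1 - (1 + z) / 2 * of_real t) powr \<nu>"
  have "\<forall>t\<in>{0..1}. 1 - (1 + z) / 2 * of_real t \<notin> \<real>\<^sub>\<le>\<^sub>0"
    using slit_mult[of "(1 + z) / 2"] D1_half_plane_maps(1)[of z] z by (auto simp: slit_iff D1_iff)
  then have "\<forall>t\<in>{0..1}. Re (1 - (1 + z) / 2 * of_real t) \<ge> 0 \<or> Im (1 - (1 + z) / 2 * of_real t) \<noteq> 0"
    by (auto simp: complex_nonpos_Reals_iff simp del: Re_divide Im_divide)
  then have "continuous_on {0..1} (\<lambda>t::real. (1 - (1 + z) / 2 * of_real t) powr \<nu>)"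
    using \<nu> by (intro continuous_on_powr_complex continuous_intros) auto
  moreover have "continuous_on {0..1} (\<lambda>t::real. complex_of_real t powr \<nu> * of_real (1 - t) powr (- s))"
    using \<nu> continuous_on_beta_integrand[of "\<nu> + 1" "1 - s"] by simp
  ultimately have "?g integrable_on {0..1}"
    by (intro integrable_continuous_real) (rule continuous_on_mult)
  then have "(?g has_integral legendre_J \<nu> s z) {0..1}"
    unfolding legendre_J_def by (rule integrable_integral)
  then show "((\<lambda>t. C * (1 + z) powr (\<nu> + 1 - s) * ?g t) has_integral
      (C * ((1 + z) powr (\<nu> + 1 - s) * legendre_J \<nu> s z))) {0..1}"
    unfolding mult.assoc[of C] by (intro has_integral_mult_right)
  fix t :: real assume t: "t \<in> {0..1}"
  have "1 + z \<noteq> 0" using z by (auto simp: complex_eq_iff)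
  then have "(1 + z) powr (\<nu> + 1 - s) = (1 + z) * (1 + z) powr (\<nu> - s)"
    using powr_minus_one_mult[of "1 + z" "\<nu> + 1 - s"] by (simp add: algebra_simps)
  then show "C * (1 + z) powr (\<nu> + 1 - s) * ?g t = f (linepath a b t) * (b - a)"
    unfolding f[OF t] ba by (simp only: mult_ac)
qed

lemma legendre_triangle_integral:
  assumes \<nu>: "Re \<nu> > 0" and s: "Re s < 0" and z: "Im z > 0"
  shows "integral {-1..1} (\<lambda>t. of_real (1 - t\<^sup>2) powr \<nu> * (z - of_real t) powr (- s))
    = 2 powr \<nu> * Gamma (\<nu> + 1) * Gamma (1 - s) * (legendre_K \<nu> s z + exp (- (\<i> * of_real pi * s)) * legendre_K \<nu> s (- z))"
proof -
  let ?f = "\<lambda>\<zeta>. (1 - \<zeta>) powr \<nu> * (1 + \<zeta>) powr \<nu> * (z - \<zeta>) powr (- s)"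
  let ?T = "convex hull {-1, 1, z}"
  let ?S = "\<lambda>z. (1 + z) powr (\<nu> + 1 - s) * legendre_J \<nu> s z"
  let ?e = "exp (- (\<i> * of_real pi * s))"
  \<comment> \<open>These bounds keep \<open>1 - \<zeta>\<close>, \<open>1 + \<zeta>\<close> and
    \<open>z - \<zeta>\<close> off the negative axis throughout the triangle; each can vanish only
    at a corner, where its power has an exponent of positive real part.\<close>
  have T: "0 \<le> Im \<zeta> \<and> Im \<zeta> \<le> Im z \<and> (Im \<zeta> = 0 \<longrightarrow> \<bar>Re \<zeta>\<bar> \<le> 1) \<and> (Im \<zeta> = Im z \<longrightarrow> \<zeta> = z)" if "\<zeta> \<in> ?T" for \<zeta>
  proof -
    from that obtain u v w where uvw: "0 \<le> u" "0 \<le> v" "0 \<le> w" "u + v + w = 1"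
      "\<zeta> = u *\<^sub>R (-1) + v *\<^sub>R 1 + w *\<^sub>R z" unfolding convex_hull_3 by blast
    then have "Im \<zeta> = w * Im z" "Re \<zeta> = v - u + w * Re z" by simp_all
    moreover have "w \<le> 1" using uvw by simp
    moreover have "w * Im z \<le> Im z" using \<open>w \<le> 1\<close> z by simp
    moreover have "\<zeta> = z" if "w = 1" using uvw that by simp
    ultimately show ?thesis using uvw z by auto
  qed
  have cont: "continuous_on ?T ?f"
    using T \<nu> s by (intro continuous_on_mult continuous_on_powr_complex continuous_intros) force+
  have hol: "?f holomorphic_on interior ?T"
  proof -
    \<comment> \<open>An interior point can be moved up and down by \<open>e\<close> inside the
      triangle, so its height is strictly between the extremes.\<close>
    have "0 < Im \<zeta> \<and> Im \<zeta> < Im z" if \<zeta>: "\<zeta> \<in> interior ?T" for \<zeta>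
    proof -
      from \<zeta> obtain e where e: "e > 0" "cball \<zeta> e \<subseteq> ?T" by (auto simp: mem_interior_cball)
      have "\<zeta> + \<i> * of_real e \<in> cball \<zeta> e" "\<zeta> - \<i> * of_real e \<in> cball \<zeta> e"
        using e by (auto simp: dist_norm norm_mult)
      with e(2) T have "Im (\<zeta> + \<i> * of_real e) \<le> Im z" "0 \<le> Im (\<zeta> - \<i> * of_real e)" by blast+
      with e(1) show ?thesis by simp
    qed
    then show ?thesis
      by (intro holomorphic_intros) (force simp: complex_nonpos_Reals_iff)+
  qed
  have side1: "(?f has_contour_integral integral {-1..1} (\<lambda>t. of_real (1 - t\<^sup>2) powr \<nu> * (z - of_real t) powr (- s))) (linepath (-1) 1)"
  proof -
    have "continuous_on {-1..1} (\<lambda>t. complex_of_real (1 - t\<^sup>2) powr \<nu> * (z - of_real t) powr (- s))"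
      using \<nu> z by (intro continuous_on_mult continuous_on_gegenbauer_weight continuous_on_powr_complex continuous_intros) auto
    then have "((\<lambda>t. complex_of_real (1 - t\<^sup>2) powr \<nu> * (z - of_real t) powr (- s)) has_integral
        integral {-1..1} (\<lambda>t. of_real (1 - t\<^sup>2) powr \<nu> * (z - of_real t) powr (- s))) {-1..1}"
      by (intro integrable_integral integrable_continuous_real)
    then have "((\<lambda>t. ?f (of_real t)) has_integral
        integral {-1..1} (\<lambda>t. of_real (1 - t\<^sup>2) powr \<nu> * (z - of_real t) powr (- s))) {-1..1}"
    proof (rule has_integral_eq[rotated])
      fix t :: real assume t: "t \<in> {-1..1}"
      have "complex_of_real (1 - t\<^sup>2) = of_real (1 - t) * of_real (1 + t)"
        by (simp add: power2_eq_square algebra_simps)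
      then have "complex_of_real (1 - t\<^sup>2) powr \<nu> = of_real (1 - t) powr \<nu> * of_real (1 + t) powr \<nu>"
        using t by (simp only:) (subst powr_times_real_left, auto)
      then show "complex_of_real (1 - t\<^sup>2) powr \<nu> * (z - of_real t) powr (- s) = ?f (of_real t)" by simp
    qed
    then show ?thesis by (subst has_contour_integral_linepath_Reals_iff) auto
  qed
  have side2: "(?f has_contour_integral - (2 powr \<nu> * ?S z)) (linepath z (-1))"
  proof -
    have "(?f has_contour_integral 2 powr \<nu> * ?S z) (linepath (-1) z)"
    proof (rule contour_integral_side[OF _ _ _ \<nu> s])
      fix t :: real assume t: "t \<in> {0..1}"
      let ?\<zeta> = "linepath (-1) z t"
      have \<zeta>: "?\<zeta> = - 1 + (1 + z) * of_real t" by (simp add: linepath_def scaleR_conv_of_real algebra_simps)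
      have 1: "1 - ?\<zeta> = of_real 2 * (1 - (1 + z) / 2 * of_real t)" by (simp add: \<zeta> field_simps)
      have 2: "1 + ?\<zeta> = of_real t * (1 + z)" by (simp add: \<zeta> algebra_simps)
      have 3: "z - ?\<zeta> = of_real (1 - t) * (1 + z)" by (simp add: \<zeta> algebra_simps)
      have "?f ?\<zeta> = (of_real 2 powr \<nu> * (1 - (1 + z) / 2 * of_real t) powr \<nu>) * (of_real t powr \<nu> * (1 + z) powr \<nu>) *
          (of_real (1 - t) powr (- s) * (1 + z) powr (- s))"
        unfolding 1 2 3 using t by (subst (1 2 3) powr_times_real_left) auto
      also have "\<dots> = 2 powr \<nu> * (((1 + z) powr \<nu> * (1 + z) powr (- s)) *
          (of_real t powr \<nu> * of_real (1 - t) powr (- s) * (1 - (1 + z) / 2 * of_real t) powr \<nu>))" by (simp add: mult_ac)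
      also have "(1 + z) powr \<nu> * (1 + z) powr (- s) = (1 + z) powr (\<nu> - s)"
        by (subst powr_add[symmetric]) simp
      finally show "?f ?\<zeta> = 2 powr \<nu> * ((1 + z) powr (\<nu> - s) *
          (of_real t powr \<nu> * of_real (1 - t) powr (- s) * (1 - (1 + z) / 2 * of_real t) powr \<nu>))" .
    qed (use z in auto)
    from has_contour_integral_reversepath[OF _ this] show ?thesis by simp
  qed
  have side3: "(?f has_contour_integral - (2 powr \<nu> * ?e * ?S (- z))) (linepath 1 z)"
  proof -
    have "((\<lambda>\<zeta>. ?f (- \<zeta>)) has_contour_integral 2 powr \<nu> * ?e * ?S (- z)) (linepath (- 1) (- z))"
    proof (rule contour_integral_side[OF _ _ _ \<nu> s])
      fix t :: real assume t: "t \<in> {0..1}"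
      let ?\<zeta> = "linepath (- 1) (- z) t"
      have \<zeta>: "?\<zeta> = - 1 + (1 - z) * of_real t" by (simp add: linepath_def scaleR_conv_of_real algebra_simps)
      have 1: "1 - (- ?\<zeta>) = of_real t * (1 + - z)" by (simp add: \<zeta> algebra_simps)
      have 2: "1 + - ?\<zeta> = of_real 2 * (1 - (1 + - z) / 2 * of_real t)" by (simp add: \<zeta> field_simps)
      have 3: "z - - ?\<zeta> = of_real (1 - t) * (z - 1)" by (simp add: \<zeta> algebra_simps)
      have 4: "(z - 1) powr (- s) = ?e * (1 + - z) powr (- s)"
        using powr_uminus_upper[of "z - 1" "- s"] z by simp
      have "?f (- ?\<zeta>) = (of_real t powr \<nu> * (1 + - z) powr \<nu>) * (of_real 2 powr \<nu> * (1 - (1 + - z) / 2 * of_real t) powr \<nu>) *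
          (of_real (1 - t) powr (- s) * (?e * (1 + - z) powr (- s)))"
        unfolding 1 2 3 4[symmetric] using t by (subst (1 2 3) powr_times_real_left) auto
      also have "\<dots> = 2 powr \<nu> * ?e * (((1 + - z) powr \<nu> * (1 + - z) powr (- s)) *
          (of_real t powr \<nu> * of_real (1 - t) powr (- s) * (1 - (1 + - z) / 2 * of_real t) powr \<nu>))" by (simp add: mult_ac)
      also have "(1 + - z) powr \<nu> * (1 + - z) powr (- s) = (1 + - z) powr (\<nu> - s)"
        by (subst powr_add[symmetric]) simp
      finally show "?f (- ?\<zeta>) = 2 powr \<nu> * ?e * ((1 + - z) powr (\<nu> - s) *
          (of_real t powr \<nu> * of_real (1 - t) powr (- s) * (1 - (1 + - z) / 2 * of_real t) powr \<nu>))" .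
    qed (use z in auto)
    \<comment> \<open>The reflection maps the segment from \<open>-1\<close> to \<open>- z\<close>
      onto the one from 1 to \<open>z\<close> and reverses the direction vector, whence the
      sign.\<close>
    then have "((\<lambda>t. - (?f (- linepath (- 1) (- z) t) * (- z - - 1))) has_integral - (2 powr \<nu> * ?e * ?S (- z))) {0..1}"
      unfolding has_contour_integral_linepath by (rule has_integral_neg)
    moreover have "- linepath (- 1) (- z) t = linepath 1 z t" for t :: real
      by (simp add: linepath_def)
    moreover have "- (x * (- z - - 1)) = x * (z - 1)" for x by (simp add: algebra_simps)
    ultimately show ?thesis unfolding has_contour_integral_linepath by simp
  qed
  let ?L = "integral {-1..1} (\<lambda>t. of_real (1 - t\<^sup>2) powr \<nu> * (z - of_real t) powr (- s))"
  have "(?f has_contour_integral (?L + (- (2 powr \<nu> * ?e * ?S (- z)) + - (2 powr \<nu> * ?S z))))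
      (linepath (-1) 1 +++ linepath 1 z +++ linepath z (-1))"
    by (intro has_contour_integral_join side1 side2 side3 valid_path_join) auto
  with Cauchy_theorem_triangle_interior[OF cont hol]
  have "?L + (- (2 powr \<nu> * ?e * ?S (- z)) + - (2 powr \<nu> * ?S z)) = 0"
    using has_contour_integral_unique by blast
  then have "?L = 2 powr \<nu> * (?S z + ?e * ?S (- z))" by (simp add: algebra_simps)
  moreover have "z \<in> D1" "- z \<in> D1" using z by (auto simp: D1_iff)
  ultimately show ?thesis using legendre_K_Euler[OF \<nu> s, of z] legendre_K_Euler[OF \<nu> s, of "- z"]
    by (simp only:) (simp add: algebra_simps)
qed

section \<open>Recurrences and the general connection formula\<close>

text \<open>Restricting the identity to an open half plane fixes the phase and still allows both
  sides to be differentiated. As a predicate of the parameters alone it can be carried along by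
  induction on shifts.\<close>

definition legendre_connection :: "complex \<Rightarrow> complex \<Rightarrow> bool" where
  "legendre_connection \<nu> s \<longleftrightarrow> (\<forall>z. Im z > 0 \<longrightarrow> legendre_I \<nu> s z = 2 powr \<nu> * Gamma (1 - s) / of_real (sqrt pi) *
      (legendre_K \<nu> s z + exp (- (\<i> * of_real pi * s)) * legendre_K \<nu> s (- z)))"

lemma upper_half_plane_D1: "Im z \<noteq> 0 \<Longrightarrow> z \<in> D1" "Im z \<noteq> 0 \<Longrightarrow> - z \<in> D1"
  by (auto simp: D1_iff)

lemma holomorphic_legendre_K_uminus: "(\<lambda>z. legendre_K \<nu> s (- z)) holomorphic_on D1"
proof -
  have "(legendre_K \<nu> s \<circ> uminus) holomorphic_on D1"
    by (rule holomorphic_on_compose_gen[OF _ holomorphic_legendre_K])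
       (auto intro!: holomorphic_intros simp: D1_half_plane_maps)
  then show ?thesis by (simp add: o_def)
qed

text \<open>Equating the two evaluations of the integral and cancelling
  \<open>Gamma (\<nu> + 1)\<close> gives the identity outside the unit disc only; the identity
  theorem extends it to the half plane.\<close>

lemma legendre_connection_base:
  assumes \<nu>: "Re \<nu> > 0" and s: "Re s < 0"
  shows "legendre_connection \<nu> s"
  unfolding legendre_connection_def
proof (intro allI impI)
  fix z :: complex assume z: "Im z > 0"
  let ?R = "\<lambda>z. 2 powr \<nu> * Gamma (1 - s) / of_real (sqrt pi) *
      (legendre_K \<nu> s z + exp (- (\<i> * of_real pi * s)) * legendre_K \<nu> s (- z))"
  let ?H = "{z. Im z > 0}" and ?U = "{z. Im z > 0} \<inter> - cball 0 1"
  have openU: "open ?U" by (intro open_Int open_halfspace_Im_gt open_Compl closed_cball)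
  have "legendre_I \<nu> s z - ?R z = 0"
  proof (rule analytic_continuation[of "\<lambda>z. legendre_I \<nu> s z - ?R z" ?H ?U "2 * \<i>"])
    show "open ?H" by (rule open_halfspace_Im_gt)
    show "connected ?H" by (intro convex_connected convex_halfspace_Im_gt)
    show "(\<lambda>z. legendre_I \<nu> s z - ?R z) holomorphic_on ?H"
      by (intro holomorphic_intros holomorphic_on_subset[OF holomorphic_legendre_I]
          holomorphic_on_subset[OF holomorphic_legendre_K] holomorphic_on_subset[OF holomorphic_legendre_K_uminus])
         (auto simp: D1_iff)
    show "2 * \<i> islimpt ?U"
      by (intro interior_limit_point) (unfold interior_open[OF openU], simp add: norm_mult)
    fix w assume w: "w \<in> ?U"
    then have "norm w > 1" "Im w > 0" by auto
    note * = legendre_I_integral[OF \<nu> this, of s] legendre_triangle_integral[OF \<nu> s \<open>Im w > 0\<close>]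
    have "Gamma (\<nu> + 1) \<noteq> 0"
      using \<nu> Re_pos_not_nonpos_Int[of "\<nu> + 1"] by (auto simp: Gamma_eq_zero_iff)
    moreover have "Gamma (\<nu> + 1) * (of_real (sqrt pi) * legendre_I \<nu> s w) = Gamma (\<nu> + 1) * (2 powr \<nu> * Gamma (1 - s) *
       (legendre_K \<nu> s w + exp (- (\<i> * of_real pi * s)) * legendre_K \<nu> s (- w)))"
      using * by (simp only: mult_ac)
    ultimately have "of_real (sqrt pi) * legendre_I \<nu> s w = 2 powr \<nu> * Gamma (1 - s) *
       (legendre_K \<nu> s w + exp (- (\<i> * of_real pi * s)) * legendre_K \<nu> s (- w))" by simp
    then show "legendre_I \<nu> s w - ?R w = 0" by (simp add: field_simps)
  qed (use z in auto)
  then show "legendre_I \<nu> s z = ?R z" by simp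
qed

section \<open>Differential recurrences for \<open>legendre_I\<close> and
  \<open>legendre_K\<close>\<close>

lemma has_field_derivative_olver2F1:
  "w \<in> slit \<Longrightarrow> (olver2F1 a b c has_field_derivative deriv (olver2F1 a b c) w) (at w)"
  using holomorphic_derivI[OF holomorphic_olver2F1 open_slit] .

lemma olver2F1_lower_c:
  "w \<in> slit \<Longrightarrow> olver2F1 a b c w = w * deriv (olver2F1 a b (c + 1)) w + c * olver2F1 a b (c + 1) w"
  using olver_germ_eq[OF olver_germ_lower_c[OF olver_germ_olver2F1]] .

lemma olver2F1_raise_a:
  "w \<in> slit \<Longrightarrow> a \<noteq> 0 \<Longrightarrow> a * olver2F1 (a + 1) b c w = w * deriv (olver2F1 a b c) w + a * olver2F1 a b c w"
  using olver_germ_eq[OF olver_germ_raise_a[OF olver_germ_olver2F1], of a w b c] by (simp add: field_simps)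

text \<open>With \<open>c = \<nu> + 2 - s\<close> this changes all three parameters in the way that
  lowering \<open>\<nu>\<close> at fixed \<open>s\<close> does in \<open>legendre_K\<close>.\<close>

lemma olver2F1_legendre_lower:
  assumes "w \<in> slit"
  shows "olver2F1 (- \<nu>) (\<nu> + 1) c w =
      (1 - 2 * w) * (w * deriv (olver2F1 (- (\<nu> + 1)) (\<nu> + 1 + 1) (c + 1)) w)
      + (c + 2 * (\<nu> + 1) * w) * olver2F1 (- (\<nu> + 1)) (\<nu> + 1 + 1) (c + 1) w"
proof -
  have "olver_germ (- \<nu>) (\<nu> + 1) c (\<lambda>w. (1 + (- 2) * w) * (w * deriv (olver2F1 (- (\<nu> + 1)) (\<nu> + 1 + 1) (c + 1)) w)
      + (c + 2 * (\<nu> + 1) * w) * olver2F1 (- (\<nu> + 1)) (\<nu> + 1 + 1) (c + 1) w)"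
  proof (rule olver_germ_shift[OF olver_germ_olver2F1])
    show "olver_coeff (- \<nu>) (\<nu> + 1) c 0 = c * olver_coeff (- (\<nu> + 1)) (\<nu> + 1 + 1) (c + 1) 0"
      using rGamma_plus1[of c] by (simp add: olver_coeff_def)
    fix n
    define X where "X = pochhammer (- (\<nu> + 1)) n * pochhammer (\<nu> + 1 + 1) n * rGamma (c + 1 + of_nat (Suc n)) / fact (Suc n)"
    have A1: "olver_coeff (- (\<nu> + 1)) (\<nu> + 1 + 1) (c + 1) (Suc n) = (- (\<nu> + 1) + of_nat n) * (\<nu> + 1 + 1 + of_nat n) * X"
      unfolding olver_coeff_def X_def pochhammer_rec' by simp
    have r: "rGamma (c + of_nat (Suc n)) = (c + of_nat (Suc n)) * rGamma (c + 1 + of_nat (Suc n))"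
      using rGamma_plus1[of "c + of_nat (Suc n)"] by (simp add: add_ac)
    have "olver_coeff (- (\<nu> + 1)) (\<nu> + 1 + 1) (c + 1) n =
        pochhammer (- (\<nu> + 1)) n * pochhammer (\<nu> + 1 + 1) n * rGamma (c + of_nat (Suc n)) / fact n"
      by (simp add: olver_coeff_def add_ac)
    then have A0: "olver_coeff (- (\<nu> + 1)) (\<nu> + 1 + 1) (c + 1) n = of_nat (Suc n) * (c + of_nat (Suc n)) * X"
      unfolding r X_def by (simp del: of_nat_Suc)
    \<comment> \<open>The spare factor \<open>\<nu> + 1\<close> from the other Pochhammer symbol
      moves the base from \<open>- \<nu>\<close> to \<open>- (\<nu> + 1)\<close>, so that everything
      becomes a multiple of \<open>X\<close>.\<close>
    have "pochhammer (- \<nu>) (Suc n) * (\<nu> + 1) = - (pochhammer (- (\<nu> + 1)) (Suc (Suc n)))"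
      by (subst pochhammer_rec[of "- (\<nu> + 1)" "Suc n"]) (simp add: algebra_simps del: pochhammer_Suc)
    also have "\<dots> = - ((- (\<nu> + 1) + of_nat (Suc n)) * ((- (\<nu> + 1) + of_nat n) * pochhammer (- (\<nu> + 1)) n))"
      by (simp only: pochhammer_rec')
    finally have p: "pochhammer (- \<nu>) (Suc n) * (\<nu> + 1) =
        - ((- (\<nu> + 1) + of_nat (Suc n)) * ((- (\<nu> + 1) + of_nat n) * pochhammer (- (\<nu> + 1)) n))" .
    have "olver_coeff (- \<nu>) (\<nu> + 1) c (Suc n) = (pochhammer (- \<nu>) (Suc n) * (\<nu> + 1)) * pochhammer (\<nu> + 1 + 1) n
        * rGamma (c + of_nat (Suc n)) / fact (Suc n)"
      unfolding olver_coeff_def pochhammer_rec[of "\<nu> + 1"] by (simp only: mult_ac)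
    then have B: "olver_coeff (- \<nu>) (\<nu> + 1) c (Suc n) =
        - ((- (\<nu> + 1) + of_nat (Suc n)) * (- (\<nu> + 1) + of_nat n)) * (c + of_nat (Suc n)) * X"
      unfolding p r X_def by (simp add: mult_ac)
    show "olver_coeff (- \<nu>) (\<nu> + 1) c (Suc n) =
        (1 * of_nat (Suc n) + c) * olver_coeff (- (\<nu> + 1)) (\<nu> + 1 + 1) (c + 1) (Suc n)
        + (- 2 * of_nat n + 2 * (\<nu> + 1)) * olver_coeff (- (\<nu> + 1)) (\<nu> + 1 + 1) (c + 1) n"
      unfolding A1 A0 B by (simp add: algebra_simps)
  qed
  from olver_germ_eq[OF this assms] show ?thesis by simp
qed

lemma has_field_derivative_legendre_I:
  fixes \<nu> s z :: complex
  assumes "Im z \<noteq> 0"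
  defines "F \<equiv> olver2F1 ((s + 1) / 2) (s / 2) (\<nu> + 3 / 2)"
  shows "(legendre_I \<nu> s has_field_derivative
     - (z powr (- s) * (s * F (1 / z\<^sup>2) + 2 * (1 / z\<^sup>2 * deriv F (1 / z\<^sup>2))) / z)) (at z)"
proof -
  have z: "z \<noteq> 0" "z \<notin> \<real>\<^sub>\<le>\<^sub>0" using assms by (auto simp: complex_nonpos_Reals_iff)
  have d1: "((\<lambda>z. z powr (- s)) has_field_derivative (- s * z powr (- s - 1))) (at z)"
    using z by (auto intro!: derivative_eq_intros)
  have d2: "((\<lambda>z. 1 / z\<^sup>2) has_field_derivative (- 2 * (1 / z\<^sup>2) / z)) (at z)"
    using z by (auto intro!: derivative_eq_intros simp: power2_eq_square field_simps)
  have d3: "((\<lambda>z. F (1 / z\<^sup>2)) has_field_derivative deriv F (1 / z\<^sup>2) * (- 2 * (1 / z\<^sup>2) / z)) (at z)"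
    unfolding F_def by (rule DERIV_chain2[OF has_field_derivative_olver2F1 d2]) (rule inverse_square_in_slit[OF assms(1)])
  have p: "z powr (- s - 1) = z powr (- s) / z" using z by (simp add: powr_diff)
  show ?thesis
    unfolding legendre_I_def[abs_def] F_def[symmetric]
    by (rule DERIV_cong[OF DERIV_mult[OF d1 d3]]) (simp add: p add_divide_distrib ring_distribs mult_ac)
qed

text \<open>For \<open>w = 1 / z\<^sup>2\<close>, differentiation acts on the hypergeometric factor
  as \<open>w * deriv + s / 2\<close>, which raises \<open>s / 2\<close> by 1. The upper parameters
  become those for \<open>s + 1\<close>, since the old \<open>(s + 1) / 2\<close> takes the place of
  the new \<open>s / 2\<close>.\<close>

lemma deriv_legendre_I:
  assumes "Im z \<noteq> 0" "s \<noteq> 0"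
  shows "(legendre_I \<nu> s has_field_derivative - (s * legendre_I \<nu> (s + 1) z)) (at z)"
proof (rule DERIV_cong[OF has_field_derivative_legendre_I[OF assms(1)]])
  let ?F = "olver2F1 ((s + 1) / 2) (s / 2) (\<nu> + 3 / 2)" and ?w = "1 / z\<^sup>2"
  have z: "z \<noteq> 0" using assms by auto
  have e: "(s + 1 + 1) / 2 = s / 2 + 1" by (simp add: field_simps)
  have "s / 2 * olver2F1 (s / 2 + 1) ((s + 1) / 2) (\<nu> + 3 / 2) ?w = ?w * deriv ?F ?w + s / 2 * ?F ?w"
    using olver2F1_raise_a[OF inverse_square_in_slit[OF assms(1)], of "s / 2" "(s + 1) / 2" "\<nu> + 3 / 2"] assms(2)
    unfolding olver2F1_commute[of "s / 2" "(s + 1) / 2"] by simp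
  then have "s * olver2F1 (s / 2 + 1) ((s + 1) / 2) (\<nu> + 3 / 2) ?w = s * ?F ?w + 2 * (?w * deriv ?F ?w)"
    by (simp add: field_simps)
  moreover have "z powr (- (s + 1)) = z powr (- s) / z"
    using z powr_diff[of z "- s" 1] by simp
  ultimately show "- (z powr (- s) * (s * ?F ?w + 2 * (?w * deriv ?F ?w)) / z) = - (s * legendre_I \<nu> (s + 1) z)"
    unfolding legendre_I_def e by (simp add: mult_ac)
qed

text \<open>The operator is chosen so that the contributions \<open>s / 2\<close> cancel: what
  remains acts as \<open>w * deriv + (\<nu> + 3 / 2)\<close> and lowers the third parameter.\<close>

lemma legendre_I_lower:
  assumes "Im z \<noteq> 0"
  shows "legendre_I \<nu> s z = (\<nu> + 3 / 2 - s / 2) * legendre_I (\<nu> + 1) s z - z / 2 * deriv (legendre_I (\<nu> + 1) s) z"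
proof -
  let ?w = "1 / z\<^sup>2"
  let ?F = "olver2F1 ((s + 1) / 2) (s / 2) (\<nu> + 3 / 2 + 1)"
  have z: "z \<noteq> 0" using assms by auto
  have c: "\<nu> + 1 + 3 / 2 = \<nu> + 3 / 2 + 1" by simp
  have "deriv (legendre_I (\<nu> + 1) s) z = - (z powr (- s) * (s * ?F ?w + 2 * (?w * deriv ?F ?w)) / z)"
    using DERIV_imp_deriv[OF has_field_derivative_legendre_I[OF assms, of "\<nu> + 1" s]] unfolding c .
  then have d: "z / 2 * deriv (legendre_I (\<nu> + 1) s) z = - (z powr (- s) * (s / 2 * ?F ?w + ?w * deriv ?F ?w))"
  proof -
    have "z / 2 * - (P * (s * A + 2 * B) / z) = - (P * (s / 2 * A + B))" for P A B
      using z by (simp add: field_simps)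
    then show ?thesis unfolding \<open>deriv (legendre_I (\<nu> + 1) s) z = _\<close> .
  qed
  show ?thesis
    unfolding d unfolding legendre_I_def c olver2F1_lower_c[OF inverse_square_in_slit[OF assms], of "(s + 1) / 2" "s / 2" "\<nu> + 3 / 2"]
    by (simp add: algebra_simps)
qed

lemma has_field_derivative_legendre_K:
  fixes \<nu> s z :: complex
  assumes "z \<in> D1"
  defines "G \<equiv> olver2F1 (- \<nu>) (\<nu> + 1) (\<nu> + 2 - s)"
  shows "(legendre_K \<nu> s has_field_derivative (1 + z) powr (\<nu> - s) *
     ((\<nu> + 1 - s) * G ((1 + z) / 2) + (1 + z) / 2 * deriv G ((1 + z) / 2))) (at z)"
proof -
  have z: "1 + z \<notin> \<real>\<^sub>\<le>\<^sub>0" using D1_half_plane_maps[OF assms(1)] by auto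
  then have nz: "1 + z \<noteq> 0" by force
  have d1: "((\<lambda>z. (1 + z) powr (\<nu> + 1 - s)) has_field_derivative ((\<nu> + 1 - s) * (1 + z) powr (\<nu> - s))) (at z)"
    using z by (auto intro!: derivative_eq_intros)
  have d2: "((\<lambda>z. G ((1 + z) / 2)) has_field_derivative deriv G ((1 + z) / 2) * (1 / 2)) (at z)"
    unfolding G_def
    by (rule DERIV_chain2[OF has_field_derivative_olver2F1]) (auto intro!: derivative_eq_intros D1_half_plane_maps assms)
  have p: "(1 + z) powr (\<nu> + 1 - s) = (1 + z) * (1 + z) powr (\<nu> - s)"
    using powr_minus_one_mult[OF nz, of "\<nu> + 1 - s"] by simp
  show ?thesis
    unfolding legendre_K_def[abs_def] G_def[symmetric]
    by (rule DERIV_cong[OF DERIV_mult[OF d1 d2]]) (unfold p, simp add: algebra_simps)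
qed

text \<open>Raising \<open>s\<close> lowers the third parameter \<open>\<nu> + 2 - s\<close>, and
  the derivative of the power \<open>\<nu> + 1 - s\<close> supplies the constant in that contiguous
  relation.\<close>

lemma deriv_legendre_K:
  assumes "z \<in> D1"
  shows "(legendre_K \<nu> s has_field_derivative legendre_K \<nu> (s + 1) z) (at z)"
proof (rule DERIV_cong[OF has_field_derivative_legendre_K[OF assms]])
  have e1: "\<nu> + 2 - (s + 1) = \<nu> + 1 - s" and e2: "\<nu> + 1 - (s + 1) = \<nu> - s" and e3: "\<nu> + 2 - s = \<nu> + 1 - s + 1"
    by simp_all
  show "(1 + z) powr (\<nu> - s) * ((\<nu> + 1 - s) * olver2F1 (- \<nu>) (\<nu> + 1) (\<nu> + 2 - s) ((1 + z) / 2) +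
      (1 + z) / 2 * deriv (olver2F1 (- \<nu>) (\<nu> + 1) (\<nu> + 2 - s)) ((1 + z) / 2)) = legendre_K \<nu> (s + 1) z"
    unfolding legendre_K_def e1 e2 unfolding e3
      olver2F1_lower_c[OF D1_half_plane_maps(1)[OF assms], of "- \<nu>" "\<nu> + 1" "\<nu> + 1 - s"]
    by (simp only: add.commute)
qed

text \<open>The operator is the one for \<open>legendre_I\<close>; the factor 1/2 is the ratio of
  the constants \<open>2 powr \<nu>\<close> and \<open>2 powr (\<nu> + 1)\<close> of the connection
  formula.\<close>

lemma legendre_K_lower:
  assumes "z \<in> D1"
  shows "legendre_K \<nu> s z / 2 = (\<nu> + 3 / 2 - s / 2) * legendre_K (\<nu> + 1) s z - z / 2 * deriv (legendre_K (\<nu> + 1) s) z"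
proof -
  define u where "u = (1 + z) / 2"
  have zu: "z = 2 * u - 1" by (simp add: u_def field_simps)
  define G where "G = olver2F1 (- (\<nu> + 1)) (\<nu> + 1 + 1) (\<nu> + 2 - s + 1)"
  have nz: "1 + z \<noteq> 0" using D1_half_plane_maps(3)[OF assms] by force
  have c: "\<nu> + 1 + 2 - s = \<nu> + 2 - s + 1" by simp
  have p: "(1 + z) powr (\<nu> + 1 + 1 - s) = 2 * u * (1 + z) powr (\<nu> + 1 - s)"
  proof -
    have u2: "2 * u = 1 + z" and e: "\<nu> + 1 + 1 - s - 1 = \<nu> + 1 - s" by (simp_all add: u_def)
    show ?thesis unfolding u2 using powr_minus_one_mult[OF nz, of "\<nu> + 1 + 1 - s"] unfolding e by (rule sym)
  qed
  have d: "deriv (legendre_K (\<nu> + 1) s) z = (1 + z) powr (\<nu> + 1 - s) * ((\<nu> + 1 + 1 - s) * G u + u * deriv G u)"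
    using DERIV_imp_deriv[OF has_field_derivative_legendre_K[OF assms, of "\<nu> + 1" s]] unfolding c u_def G_def .
  have l: "olver2F1 (- \<nu>) (\<nu> + 1) (\<nu> + 2 - s) u = (1 - 2 * u) * (u * deriv G u) + (\<nu> + 2 - s + 2 * (\<nu> + 1) * u) * G u"
    unfolding G_def by (rule olver2F1_legendre_lower) (auto simp: u_def D1_half_plane_maps assms)
  have "P * ((1 - 2 * u) * (u * d) + (\<nu> + 2 - s + 2 * (\<nu> + 1) * u) * g) / 2
      = (\<nu> + 3 / 2 - s / 2) * (2 * u * P * g) - (2 * u - 1) / 2 * (P * ((\<nu> + 1 + 1 - s) * g + u * d))" for P d g
    by (simp add: field_simps)
  then show ?thesis
    unfolding d zu[symmetric] unfolding legendre_K_def c p u_def[symmetric] G_def[symmetric] l .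
qed

text \<open>Both sides are differentiated. The factor \<open>- s\<close> on the left is matched by
  \<open>Gamma (1 - s) = - s * Gamma (- s)\<close>.\<close>

lemma legendre_connection_shift_s:
  assumes "legendre_connection \<nu> s" "s \<notin> \<int>"
  shows "legendre_connection \<nu> (s + 1)"
  unfolding legendre_connection_def
proof (intro allI impI)
  fix z :: complex assume z: "Im z > 0"
  have s: "s \<noteq> 0" "- s \<notin> \<int>\<^sub>\<le>\<^sub>0" using assms(2) by (auto dest: nonpos_Ints_Int simp: minus_in_Ints_iff)
  let ?C = "2 powr \<nu> * Gamma (1 - s) / of_real (sqrt pi)" and ?e = "exp (- (\<i> * of_real pi * s))"
  have zD: "z \<in> D1" "- z \<in> D1" using z by (auto intro: upper_half_plane_D1)
  have "((\<lambda>z. ?C * (legendre_K \<nu> s z + ?e * legendre_K \<nu> s (- z))) has_field_derivative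
      ?C * (legendre_K \<nu> (s + 1) z + ?e * (legendre_K \<nu> (s + 1) (- z) * (- 1)))) (at z)"
  proof (intro DERIV_cmult DERIV_add deriv_legendre_K zD)
    show "((\<lambda>z. legendre_K \<nu> s (- z)) has_field_derivative legendre_K \<nu> (s + 1) (- z) * (- 1)) (at z)"
      by (rule DERIV_chain2[where f = "legendre_K \<nu> s" and g = uminus])
         (auto intro!: derivative_eq_intros deriv_legendre_K zD)
  qed
  then have "(legendre_I \<nu> s has_field_derivative
      ?C * (legendre_K \<nu> (s + 1) z + ?e * (legendre_K \<nu> (s + 1) (- z) * (- 1)))) (at z)"
    by (rule has_field_derivative_transform_within_open[OF _ open_halfspace_Im_gt[of 0]])
       (use z assms(1) in \<open>auto simp: legendre_connection_def\<close>)
  moreover have "(legendre_I \<nu> s has_field_derivative - (s * legendre_I \<nu> (s + 1) z)) (at z)"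
    using z s by (intro deriv_legendre_I) auto
  ultimately have "- (s * legendre_I \<nu> (s + 1) z) = ?C * (legendre_K \<nu> (s + 1) z + ?e * (legendre_K \<nu> (s + 1) (- z) * (- 1)))"
    by (rule DERIV_unique[rotated])
  also have "Gamma (1 - s) = - s * Gamma (- s)" using Gamma_plus1[OF s(2)] by simp
  finally have "s * legendre_I \<nu> (s + 1) z =
      s * (2 powr \<nu> * Gamma (- s) / of_real (sqrt pi) * (legendre_K \<nu> (s + 1) z - ?e * legendre_K \<nu> (s + 1) (- z)))"
    by (simp add: mult_ac)
  then have "legendre_I \<nu> (s + 1) z =
      2 powr \<nu> * Gamma (- s) / of_real (sqrt pi) * (legendre_K \<nu> (s + 1) z - ?e * legendre_K \<nu> (s + 1) (- z))"
    using s(1) by (simp only: mult_cancel_left) simp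
  \<comment> \<open>This sign is the one that the chain rule produces in the term with
    \<open>- z\<close>.\<close>
  moreover have "exp (- (\<i> * of_real pi * (s + 1))) = - ?e"
    by (simp add: ring_distribs exp_diff exp_minus)
  ultimately show "legendre_I \<nu> (s + 1) z = 2 powr \<nu> * Gamma (1 - (s + 1)) / of_real (sqrt pi) *
      (legendre_K \<nu> (s + 1) z + exp (- (\<i> * of_real pi * (s + 1))) * legendre_K \<nu> (s + 1) (- z))"
    by simp
qed

text \<open>The operator \<open>z * deriv\<close> commutes with \<open>z \<mapsto> - z\<close>, so
  it acts in the same way on both terms and the phase stays as it is.\<close>

lemma legendre_connection_lower:
  assumes "legendre_connection (\<nu> + 1) s"
  shows "legendre_connection \<nu> s"
  unfolding legendre_connection_def
proof (intro allI impI)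
  fix z :: complex assume z: "Im z > 0"
  let ?C = "2 powr (\<nu> + 1) * Gamma (1 - s) / of_real (sqrt pi)" and ?e = "exp (- (\<i> * of_real pi * s))"
  let ?K = "legendre_K (\<nu> + 1) s"
  have zD: "z \<in> D1" "- z \<in> D1" using z by (auto intro: upper_half_plane_D1)
  have dK: "(?K has_field_derivative deriv ?K w) (at w)" if "w \<in> D1" for w
    using holomorphic_derivI[OF holomorphic_legendre_K open_D1 that] .
  have "((\<lambda>z. ?C * (?K z + ?e * ?K (- z))) has_field_derivative
      ?C * (deriv ?K z + ?e * (deriv ?K (- z) * (- 1)))) (at z)"
  proof (intro DERIV_cmult DERIV_add dK zD)
    show "((\<lambda>z. ?K (- z)) has_field_derivative deriv ?K (- z) * (- 1)) (at z)"
      by (rule DERIV_chain2[where f = ?K and g = uminus])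
         (auto intro!: derivative_eq_intros dK zD)
  qed
  then have "(legendre_I (\<nu> + 1) s has_field_derivative
      ?C * (deriv ?K z + ?e * (deriv ?K (- z) * (- 1)))) (at z)"
    by (rule has_field_derivative_transform_within_open[OF _ open_halfspace_Im_gt[of 0]])
       (use z assms(1) in \<open>auto simp: legendre_connection_def\<close>)
  then have d: "deriv (legendre_I (\<nu> + 1) s) z = ?C * (deriv ?K z + ?e * (deriv ?K (- z) * (- 1)))"
    by (rule DERIV_imp_deriv)
  have I: "legendre_I (\<nu> + 1) s z = ?C * (?K z + ?e * ?K (- z))"
    using assms z by (simp add: legendre_connection_def)
  have "legendre_I \<nu> s z = (\<nu> + 3 / 2 - s / 2) * (?C * (?K z + ?e * ?K (- z)))
      - z / 2 * (?C * (deriv ?K z + ?e * (deriv ?K (- z) * (- 1))))"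
    using legendre_I_lower[of z \<nu> s] z unfolding d I by simp
  also have "\<dots> = ?C * (((\<nu> + 3 / 2 - s / 2) * ?K z - z / 2 * deriv ?K z) +
      ?e * ((\<nu> + 3 / 2 - s / 2) * ?K (- z) - (- z) / 2 * deriv ?K (- z)))"
  proof -
    have "m * (C * (k + e * k')) - z / 2 * (C * (d + e * (d' * (- 1)))) =
        C * ((m * k - z / 2 * d) + e * (m * k' - (- z) / 2 * d'))" for m C k e k' d d' :: complex
      by (simp add: algebra_simps)
    then show ?thesis .
  qed
  also have "\<dots> = ?C * (legendre_K \<nu> s z / 2 + ?e * (legendre_K \<nu> s (- z) / 2))"
    unfolding legendre_K_lower[OF zD(1)] legendre_K_lower[OF zD(2)] ..
  also have "\<dots> = 2 powr \<nu> * Gamma (1 - s) / of_real (sqrt pi) * (legendre_K \<nu> s z + ?e * legendre_K \<nu> s (- z))"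
    by (simp add: powr_add field_simps)
  finally show "legendre_I \<nu> s z = 2 powr \<nu> * Gamma (1 - s) / of_real (sqrt pi) * (legendre_K \<nu> s z + ?e * legendre_K \<nu> s (- z))" .
qed

lemma legendre_connection:
  assumes "s \<notin> \<int>"
  shows "legendre_connection \<nu> s"
proof -
  obtain N where N: "real N > - Re \<nu>" using reals_Archimedean2 by blast
  obtain M where M: "real M > Re s" using reals_Archimedean2 by blast
  \<comment> \<open>The start \<open>(\<nu> + N, s - M)\<close> lies in the region of the integral
    representation; \<open>s\<close> is raised first, then \<open>\<nu>\<close> is lowered.\<close>
  have "legendre_connection (\<nu> + of_nat N) (s - of_nat M + of_nat k)" for k
  proof (induction k)
    case 0
    show ?case using N M by (intro legendre_connection_base) auto
  next
    case (Suc k)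
    have "s - of_nat M + of_nat k \<notin> \<int>"
    proof
      assume "s - of_nat M + of_nat k \<in> \<int>"
      then have "(s - of_nat M + of_nat k) + (of_nat M - of_nat k) \<in> \<int>"
        by (rule Ints_add) (intro Ints_diff Ints_of_nat)
      also have "(s - of_nat M + of_nat k) + (of_nat M - of_nat k) = s" by simp
      finally show False using assms by simp
    qed
    from legendre_connection_shift_s[OF Suc this] show ?case by (simp add: add_ac)
  qed
  from this[of M] have "legendre_connection (\<nu> + of_nat N) s" by simp
  then show ?thesis
  proof (induction N)
    case (Suc N)
    then show ?case using legendre_connection_lower[of "\<nu> + of_nat N" s] by (simp add: add_ac)
  qed simp
qed

section \<open>Boundary values on the cut\<close>

lemma legendre_I_lower_half_plane:
  assumes "s \<notin> \<int>" "Im z < 0"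
  shows "legendre_I \<nu> s z = 2 powr \<nu> * Gamma (1 - s) / of_real (sqrt pi) *
      (legendre_K \<nu> s z + exp (\<i> * of_real pi * s) * legendre_K \<nu> s (- z))"
proof -
  let ?e = "exp (\<i> * of_real pi * s)"
  \<comment> \<open>The hypergeometric factor depends on \<open>z\<^sup>2\<close> only, so the power
    alone contributes when the upper half plane is reflected to the lower one.\<close>
  have "(- z) powr (- s) = exp (\<i> * of_real pi * (- s)) * z powr (- s)"
    using powr_uminus_upper[of "- z" "- s"] assms(2) by simp
  then have "z powr (- s) = ?e * (- z) powr (- s)" by (simp add: exp_minus)
  then have "legendre_I \<nu> s z = ?e * legendre_I \<nu> s (- z)"
    by (simp add: legendre_I_def)
  also have "legendre_I \<nu> s (- z) = 2 powr \<nu> * Gamma (1 - s) / of_real (sqrt pi) *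
      (legendre_K \<nu> s (- z) + exp (- (\<i> * of_real pi * s)) * legendre_K \<nu> s z)"
    using legendre_connection[OF assms(1), of \<nu>] assms(2) by (simp add: legendre_connection_def)
  also have "?e * (C * (k + exp (- (\<i> * of_real pi * s)) * k')) = C * (k' + ?e * k)" for C k k'
    by (simp add: exp_minus field_simps)
  finally show ?thesis .
qed

text \<open>Up to a phase this is \<open>legendre_Q\<close> off the real axis, with
  \<open>\<epsilon> = exp (- \<i> * pi * s)\<close> above and
  \<open>\<epsilon> = exp (\<i> * pi * s)\<close> below for \<open>s = \<nu> + \<mu> + 1\<close>.
  Writing \<open>1 - z\<close> in place of \<open>z - 1\<close> makes it holomorphic across the
  cut.\<close>

definition legendre_boundary :: "complex \<Rightarrow> complex \<Rightarrow> complex \<Rightarrow> complex \<Rightarrow> complex" where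
  "legendre_boundary \<epsilon> \<nu> \<mu> z = Gamma (\<nu> + \<mu> + 1) * Gamma (- (\<nu> + \<mu>)) / 2 * ((1 + z) powr (\<mu> / 2) * (1 - z) powr (\<mu> / 2)) *
     (legendre_K \<nu> (\<nu> + \<mu> + 1) z + \<epsilon> * legendre_K \<nu> (\<nu> + \<mu> + 1) (- z))"

lemma continuous_on_legendre_boundary: "continuous_on D1 (legendre_boundary \<epsilon> \<nu> \<mu>)"
  unfolding legendre_boundary_def[abs_def]
  by (intro holomorphic_on_imp_continuous_on holomorphic_intros
      holomorphic_legendre_K holomorphic_legendre_K_uminus) (auto simp: D1_half_plane_maps)

text \<open>The roots of \<open>pi\<close> and powers of 2 in \<open>legendre_Q\<close> and in the
  connection formula cancel up to 1/2. Both half planes are covered, with \<open>\<phi>\<close>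
  recording the phase between \<open>z - 1\<close> and \<open>1 - z\<close>.\<close>

lemma legendre_Q_eq_boundary:
  assumes "Im z \<noteq> 0" "\<nu> + \<mu> \<notin> \<int>"
    and I: "legendre_I \<nu> (\<nu> + \<mu> + 1) z = 2 powr \<nu> * Gamma (- (\<nu> + \<mu>)) / of_real (sqrt pi) *
      (legendre_K \<nu> (\<nu> + \<mu> + 1) z + \<epsilon> * legendre_K \<nu> (\<nu> + \<mu> + 1) (- z))"
    and \<phi>: "(z - 1) powr (\<mu> / 2) = \<phi> * (1 - z) powr (\<mu> / 2)"
  shows "legendre_Q \<nu> \<mu> z = exp (\<i> * of_real pi * \<mu>) * \<phi> * legendre_boundary \<epsilon> \<nu> \<mu> z"
proof -
  have z: "z \<noteq> 0" using assms by auto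
  have e: "\<nu> + \<mu> + 1 + 1 = \<nu> + \<mu> + 2" by simp
  have h: "hyp2F1_over_Gamma ((\<nu> + \<mu> + 2) / 2) ((\<nu> + \<mu> + 1) / 2) (\<nu> + 3 / 2) (1 / z\<^sup>2) / z powr (\<nu> + \<mu> + 1)
      = legendre_I \<nu> (\<nu> + \<mu> + 1) z"
    unfolding legendre_I_def hyp2F1_over_Gamma_eq[OF inverse_square_in_slit[OF assms(1)]] e powr_minus
    by (rule trans[OF divide_inverse mult.commute])
  have "P * E * G * (a * b) / (X * Y) * H = P * E * G * (a * b) / X * (H / Y)" for P E G a b X Y H :: complex
    by simp
  then have Q: "legendre_Q \<nu> \<mu> z = of_real (sqrt pi) * exp (\<i> * of_real pi * \<mu>) * Gamma (\<nu> + \<mu> + 1)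
      * ((z + 1) powr (\<mu> / 2) * (z - 1) powr (\<mu> / 2)) / 2 powr (\<nu> + 1) * legendre_I \<nu> (\<nu> + \<mu> + 1) z"
    unfolding legendre_Q_def h[symmetric] .
  have two: "2 powr (\<nu> + 1) = 2 * 2 powr \<nu>" by (simp add: powr_add)
  have "of_real (sqrt pi) * E * G * (a * (\<phi> * b)) / (2 * 2 powr \<nu>) * (2 powr \<nu> * H / of_real (sqrt pi) * k)
      = E * \<phi> * (G * H / 2 * (a * b) * k)" for E G a b H k :: complex
    by (simp add: field_simps)
  then show ?thesis
    unfolding Q two legendre_boundary_def I \<phi> add.commute[of z 1] .
qed

lemma legendre_Q_half_planes:
  assumes "\<nu> + \<mu> \<notin> \<int>"
  defines "e \<equiv> exp (\<i> * of_real pi * \<mu>)"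
  shows "Im z > 0 \<Longrightarrow> legendre_Q \<nu> \<mu> z = e * exp (\<i> * of_real pi * \<mu> / 2)
      * legendre_boundary (exp (- (\<i> * of_real pi * (\<nu> + \<mu> + 1)))) \<nu> \<mu> z"
    and "Im z < 0 \<Longrightarrow> legendre_Q \<nu> \<mu> z = e * exp (- \<i> * of_real pi * \<mu> / 2)
      * legendre_boundary (exp (\<i> * of_real pi * (\<nu> + \<mu> + 1))) \<nu> \<mu> z"
proof -
  have s: "\<nu> + \<mu> + 1 \<notin> \<int>"
  proof
    assume "\<nu> + \<mu> + 1 \<in> \<int>"
    then have "\<nu> + \<mu> + 1 - 1 \<in> \<int>" by (rule Ints_diff) (rule Ints_1)
    also have "\<nu> + \<mu> + 1 - 1 = \<nu> + \<mu>" by simp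
    finally show False using assms by simp
  qed
  have g: "1 - (\<nu> + \<mu> + 1) = - (\<nu> + \<mu>)" by simp
  { assume z: "Im z > 0"
    show "legendre_Q \<nu> \<mu> z = e * exp (\<i> * of_real pi * \<mu> / 2)
      * legendre_boundary (exp (- (\<i> * of_real pi * (\<nu> + \<mu> + 1)))) \<nu> \<mu> z"
      unfolding e_def
    proof (rule legendre_Q_eq_boundary)
      show "(z - 1) powr (\<mu> / 2) = exp (\<i> * of_real pi * \<mu> / 2) * (1 - z) powr (\<mu> / 2)"
        using powr_uminus_upper[of "z - 1" "\<mu> / 2"] z by simp
    qed (use z assms legendre_connection[OF s, of \<nu>] in \<open>auto simp: legendre_connection_def g\<close>) }
  { assume z: "Im z < 0"
    show "legendre_Q \<nu> \<mu> z = e * exp (- \<i> * of_real pi * \<mu> / 2)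
      * legendre_boundary (exp (\<i> * of_real pi * (\<nu> + \<mu> + 1))) \<nu> \<mu> z"
      unfolding e_def
    proof (rule legendre_Q_eq_boundary)
      show "(z - 1) powr (\<mu> / 2) = exp (- \<i> * of_real pi * \<mu> / 2) * (1 - z) powr (\<mu> / 2)"
        using powr_uminus_upper[of "1 - z" "\<mu> / 2"] z by (simp add: exp_minus)
    qed (use z assms legendre_I_lower_half_plane[OF s, of z \<nu>] in \<open>auto simp: g\<close>) }
qed

text \<open>A one-sided limit becomes the value of a function that is continuous across the
  cut.\<close>

lemma Lim_eq_continuous:
  fixes f g :: "complex \<Rightarrow> complex"
  assumes "open D" "x \<in> D" "continuous_on D g" "x islimpt S" "\<And>z. z \<in> S \<Longrightarrow> f z = c * g z"
  shows "Lim (at x within S) f = c * g x"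
proof (rule tendsto_Lim)
  show "at x within S \<noteq> bot" using assms(4) by (simp add: trivial_limit_within)
  have "(g \<longlongrightarrow> g x) (at x within S)"
    using assms(1-3) continuous_on_eq_continuous_at tendsto_within_subset[OF _ subset_UNIV]
    by (force simp: continuous_at isCont_def)
  then have "((\<lambda>z. c * g z) \<longlongrightarrow> c * g x) (at x within S)" by (intro tendsto_intros)
  then show "(f \<longlongrightarrow> c * g x) (at x within S)"
    by (rule Lim_transform_eventually) (auto simp: eventually_at_topological assms(5))
qed

lemma real_islimpt_half_planes:
  assumes "Im x = 0"
  shows "x islimpt {z. Im z > 0}" "x islimpt {z. Im z < 0}"
proof -
  have *: "x islimpt S" if "\<And>r. r > 0 \<Longrightarrow> x + of_real r * c \<in> S" "norm c = 1" for S c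
    unfolding islimpt_approachable
  proof (intro allI impI)
    fix e :: real assume e: "e > 0"
    show "\<exists>x'\<in>S. x' \<noteq> x \<and> dist x' x < e"
      using e that(1)[of "e / 2"] that(2)
      by (intro bexI[of _ "x + of_real (e / 2) * c"]) (auto simp: dist_norm norm_mult norm_divide)
  qed
  show "x islimpt {z. Im z > 0}" by (rule *[of \<i>]) (use assms in auto)
  show "x islimpt {z. Im z < 0}" by (rule *[of "- \<i>"]) (use assms in auto)
qed

text \<open>The exponential weights in the definition of \<open>ferrers_Q_cut\<close> are the
  inverses of the two phases of \<open>legendre_Q\<close>, so a plain average remains.\<close>

lemma ferrers_Q_cut_eq:
  assumes "\<nu> + \<mu> \<notin> \<int>" "x \<in> D1" "Im x = 0"
  shows "ferrers_Q_cut \<nu> \<mu> x = (legendre_boundary (exp (- (\<i> * of_real pi * (\<nu> + \<mu> + 1)))) \<nu> \<mu> x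
      + legendre_boundary (exp (\<i> * of_real pi * (\<nu> + \<mu> + 1))) \<nu> \<mu> x) / 2"
proof -
  let ?e = "exp (\<i> * of_real pi * \<mu>)" and ?h = "exp (\<i> * of_real pi * \<mu> / 2)"
  note L = Lim_eq_continuous[OF open_D1 assms(2) continuous_on_legendre_boundary]
  have 1: "Lim (at x within {z. Im z > 0}) (legendre_Q \<nu> \<mu>) =
      ?e * ?h * legendre_boundary (exp (- (\<i> * of_real pi * (\<nu> + \<mu> + 1)))) \<nu> \<mu> x"
    by (rule L) (use assms real_islimpt_half_planes legendre_Q_half_planes in auto)
  have 2: "Lim (at x within {z. Im z < 0}) (legendre_Q \<nu> \<mu>) =
      ?e * exp (- \<i> * of_real pi * \<mu> / 2) * legendre_boundary (exp (\<i> * of_real pi * (\<nu> + \<mu> + 1))) \<nu> \<mu> x"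
    by (rule L) (use assms real_islimpt_half_planes legendre_Q_half_planes in auto)
  show ?thesis
    unfolding ferrers_Q_cut_def 1 2 by (simp add: exp_minus field_simps)
qed

section \<open>The Ferrers function\<close>

lemma powr_divide_of_real:
  assumes "p > 0" "q > 0"
  shows "(complex_of_real p / of_real q) powr m = of_real p powr m / of_real q powr m"
proof -
  have "Ln (complex_of_real p / of_real q) = Ln (of_real p) - Ln (of_real q)"
    using assms Ln_of_real[of "p / q"] by (simp add: Ln_of_real ln_div)
  then show ?thesis using assms by (simp add: powr_def right_diff_distrib exp_diff)
qed

text \<open>If the quotient equals \<open>r \<le> 0\<close>, then
  \<open>x = (r - 1) / (r + 1)\<close> is real of modulus at least 1, contrary to membership in
  \<open>D1\<close>.\<close>

lemma D1_quotient:
  assumes "x \<in> D1"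
  shows "(1 + x) / (1 - x) \<notin> \<real>\<^sub>\<le>\<^sub>0"
proof
  assume "(1 + x) / (1 - x) \<in> \<real>\<^sub>\<le>\<^sub>0"
  then obtain r where r: "(1 + x) / (1 - x) = of_real r" "r \<le> 0" by (auto elim: nonpos_Reals_cases)
  have "1 - x \<noteq> 0" using D1_half_plane_maps(4)[OF assms] by force
  then have e: "x * (1 + of_real r) = of_real r - 1" using r(1) by (simp add: field_simps)
  have "r \<noteq> -1" using e by auto
  then have "1 + complex_of_real r \<noteq> 0" by (metis add_eq_0_iff of_real_1 of_real_eq_iff of_real_minus)
  with e have "x = (of_real r - 1) / (1 + of_real r)" by (simp add: field_simps)
  then have x: "x = of_real ((r - 1) / (1 + r))" by simp
  have "\<bar>(r - 1) / (1 + r)\<bar> \<ge> 1" using r(2) \<open>r \<noteq> -1\<close> by (simp add: abs_divide field_simps)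
  with assms show False unfolding x D1_iff by simp
qed

lemma zero_islimpt_cut: "(0::complex) islimpt of_real ` {-1<..<1}"
  unfolding islimpt_approachable
proof (intro allI impI)
  fix e :: real assume "e > 0"
  then show "\<exists>x'\<in>of_real ` {-1<..<1}. x' \<noteq> (0::complex) \<and> dist x' 0 < e"
    by (intro bexI[of _ "of_real (min (e / 2) (1 / 2))"] imageI) (auto simp: min_def)
qed

text \<open>For real \<open>t\<close> the powers of \<open>1 + x\<close> and \<open>1 - x\<close>
  combine into powers of quotients. The term with \<open>legendre_K\<close> at \<open>x\<close> is
  common to both boundary functions and gives the cosecant; the term at \<open>- x\<close> carries
  the two phases, whose sum gives the cosine in the cotangent.\<close>

lemma legendre_boundary_average:
  assumes "-1 < t" "t < 1" "\<nu> + \<mu> \<notin> \<int>"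
  defines "x \<equiv> complex_of_real t"
  shows "(legendre_boundary (exp (- (\<i> * of_real pi * (\<nu> + \<mu> + 1)))) \<nu> \<mu> x
      + legendre_boundary (exp (\<i> * of_real pi * (\<nu> + \<mu> + 1))) \<nu> \<mu> x) / 2 =
      of_real pi / 2 * cot (of_real pi * (\<nu> + \<mu>)) * ((1 + x) / (1 - x)) powr (\<mu> / 2)
        * olver2F1 (- \<nu>) (\<nu> + 1) (1 - \<mu>) ((1 - x) / 2)
    - of_real pi / 2 * (1 / sin (of_real pi * (\<nu> + \<mu>))) * ((1 - x) / (1 + x)) powr (\<mu> / 2)
        * olver2F1 (- \<nu>) (\<nu> + 1) (1 - \<mu>) ((1 + x) / 2)"
proof -
  define \<theta> where "\<theta> = \<nu> + \<mu>"
  define a where "a = (1 + x) powr (\<mu> / 2)"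
  define b where "b = (1 - x) powr (\<mu> / 2)"
  define A where "A = olver2F1 (- \<nu>) (\<nu> + 1) (1 - \<mu>) ((1 + x) / 2)"
  define B where "B = olver2F1 (- \<nu>) (\<nu> + 1) (1 - \<mu>) ((1 - x) / 2)"
  have x: "1 + x = of_real (1 + t)" "1 - x = of_real (1 - t)" by (simp_all add: x_def)
  have nz: "1 + x \<noteq> 0" "1 - x \<noteq> 0" using assms(1,2) unfolding x of_real_eq_0_iff by auto
  then have ab: "a \<noteq> 0" "b \<noteq> 0" by (auto simp: a_def b_def)
  have q: "((1 + x) / (1 - x)) powr (\<mu> / 2) = a / b" "((1 - x) / (1 + x)) powr (\<mu> / 2) = b / a"
    unfolding a_def b_def x by (rule powr_divide_of_real; use assms(1,2) in simp)+
  have "w powr (- \<mu>) = 1 / (w powr (\<mu> / 2) * w powr (\<mu> / 2))" for w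
    by (subst powr_add[symmetric]) (simp add: powr_minus inverse_eq_divide)
  then have p: "(1 + x) powr (- \<mu>) = 1 / (a * a)" "(1 - x) powr (- \<mu>) = 1 / (b * b)"
    unfolding a_def b_def by blast+
  have k: "\<nu> + 1 - (\<nu> + \<mu> + 1) = - \<mu>" "\<nu> + 2 - (\<nu> + \<mu> + 1) = 1 - \<mu>" by simp_all
  have K: "legendre_K \<nu> (\<nu> + \<mu> + 1) x = 1 / (a * a) * A" "legendre_K \<nu> (\<nu> + \<mu> + 1) (- x) = 1 / (b * b) * B"
    unfolding legendre_K_def k A_def B_def using p by simp_all
  have e: "exp (- (\<i> * of_real pi * (\<theta> + 1))) + exp (\<i> * of_real pi * (\<theta> + 1)) = - 2 * cos (of_real pi * \<theta>)"
  proof -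
    have "cos (of_real pi * (\<theta> + 1)) = - cos (of_real pi * \<theta>)"
      by (simp add: ring_distribs cos_add cos_of_real sin_of_real)
    moreover have "cos (of_real pi * (\<theta> + 1)) = (exp (\<i> * of_real pi * (\<theta> + 1)) + exp (- (\<i> * of_real pi * (\<theta> + 1)))) / 2"
      by (simp only: cos_exp_eq mult.assoc)
    moreover have "q + p = - 2 * c" if "y = - c" "y = (p + q) / 2" for y c p q :: complex
      using that by (simp add: add.commute)
    ultimately show ?thesis by blast
  qed
  \<comment> \<open>Reflection is applied at \<open>\<theta> + 1\<close>; the sign comes from
    shifting the sine by \<open>pi\<close>.\<close>
  have g: "Gamma (\<theta> + 1) * Gamma (- \<theta>) = - (of_real pi / sin (of_real pi * \<theta>))"
    using Gamma_reflection_complex[of "\<theta> + 1"]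
    by (simp add: ring_distribs sin_add cos_of_real sin_of_real)
  have "(G / 2 * (a * b) * (1 / (a * a) * A + e1 * (1 / (b * b) * B)) + G / 2 * (a * b) * (1 / (a * a) * A + e2 * (1 / (b * b) * B))) / 2
      = G / 2 * (b / a) * A + G / 4 * (e1 + e2) * (a / b) * B" for G e1 e2
    using ab by (simp add: field_simps)
  then have "(legendre_boundary (exp (- (\<i> * of_real pi * (\<nu> + \<mu> + 1)))) \<nu> \<mu> x
      + legendre_boundary (exp (\<i> * of_real pi * (\<nu> + \<mu> + 1))) \<nu> \<mu> x) / 2
    = (Gamma (\<theta> + 1) * Gamma (- \<theta>)) / 2 * (b / a) * A + (Gamma (\<theta> + 1) * Gamma (- \<theta>)) / 4 *
      (exp (- (\<i> * of_real pi * (\<theta> + 1))) + exp (\<i> * of_real pi * (\<theta> + 1))) * (a / b) * B"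
    unfolding legendre_boundary_def K a_def[symmetric] b_def[symmetric] unfolding \<theta>_def .
  also have "\<dots> = of_real pi / 2 * (cos (of_real pi * \<theta>) / sin (of_real pi * \<theta>)) * (a / b) * B
      - of_real pi / 2 * (1 / sin (of_real pi * \<theta>)) * (b / a) * A"
    unfolding e g by simp
  finally show ?thesis
    unfolding q A_def[symmetric] B_def[symmetric] \<theta>_def[symmetric] cot_def .
qed

text \<open>The right-hand side is holomorphic on the connected set \<open>D1\<close>, so uniqueness
  of the continuation reduces the claim to real points of the cut, where powers of quotients
  split.\<close>

theorem theorem3p9:
  fixes x \<mu> \<nu> :: complex
  assumes "x \<in> D1" and "\<nu> + \<mu> \<notin> \<int>"
  shows "ferrers_Q \<nu> \<mu> x =
      of_real pi / 2 * cot (of_real pi * (\<nu> + \<mu>)) * ((1 + x) / (1 - x)) powr (\<mu> / 2)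
        * hyp2F1_over_Gamma (- \<nu>) (\<nu> + 1) (1 - \<mu>) ((1 - x) / 2)
    - of_real pi / 2 * (1 / sin (of_real pi * (\<nu> + \<mu>))) * ((1 - x) / (1 + x)) powr (\<mu> / 2)
        * hyp2F1_over_Gamma (- \<nu>) (\<nu> + 1) (1 - \<mu>) ((1 + x) / 2)"
  unfolding ferrers_Q_def hyp2F1_over_Gamma_eq[OF D1_half_plane_maps(1)[OF assms(1)]]
    hyp2F1_over_Gamma_eq[OF D1_half_plane_maps(2)[OF assms(1)]]
proof (rule continuation_eqI[OF open_D1 connected_D1 _ _ zero_islimpt_cut _ _ assms(1)])
  \<comment> \<open>\<open>D1\<close> is symmetric, so this quotient is the previous one at
    \<open>- z\<close>.\<close>
  have *: "(1 - z) / (1 + z) \<notin> \<real>\<^sub>\<le>\<^sub>0" if "z \<in> D1" for z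
    using D1_quotient[of "- z"] D1_half_plane_maps(5)[OF that] by simp
  have "1 + z \<noteq> 0" "1 - z \<noteq> 0" if "z \<in> D1" for z
    using D1_half_plane_maps(3,4)[OF that] by force+
  then show "(\<lambda>x. of_real pi / 2 * cot (of_real pi * (\<nu> + \<mu>)) * ((1 + x) / (1 - x)) powr (\<mu> / 2)
        * olver2F1 (- \<nu>) (\<nu> + 1) (1 - \<mu>) ((1 - x) / 2)
    - of_real pi / 2 * (1 / sin (of_real pi * (\<nu> + \<mu>))) * ((1 - x) / (1 + x)) powr (\<mu> / 2)
        * olver2F1 (- \<nu>) (\<nu> + 1) (1 - \<mu>) ((1 + x) / 2)) holomorphic_on D1"
    by (intro holomorphic_on_diff holomorphic_on_mult holomorphic_olver2F1_half holomorphic_on_const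
        holomorphic_on_powr holomorphic_on_divide holomorphic_on_add holomorphic_on_ident)
       (auto simp: D1_quotient *)
  fix z :: complex assume "z \<in> of_real ` {-1<..<1}"
  then obtain t where t: "-1 < t" "t < 1" "z = of_real t" by auto
  have "ferrers_Q_cut \<nu> \<mu> z = (legendre_boundary (exp (- (\<i> * of_real pi * (\<nu> + \<mu> + 1)))) \<nu> \<mu> z
      + legendre_boundary (exp (\<i> * of_real pi * (\<nu> + \<mu> + 1))) \<nu> \<mu> z) / 2"
    using t by (intro ferrers_Q_cut_eq assms(2)) (auto simp: D1_iff)
  then show "of_real pi / 2 * cot (of_real pi * (\<nu> + \<mu>)) * ((1 + z) / (1 - z)) powr (\<mu> / 2)
        * olver2F1 (- \<nu>) (\<nu> + 1) (1 - \<mu>) ((1 - z) / 2)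
    - of_real pi / 2 * (1 / sin (of_real pi * (\<nu> + \<mu>))) * ((1 - z) / (1 + z)) powr (\<mu> / 2)
        * olver2F1 (- \<nu>) (\<nu> + 1) (1 - \<mu>) ((1 + z) / 2) = ferrers_Q_cut \<nu> \<mu> z"
    unfolding t(3) using legendre_boundary_average[OF t(1,2) assms(2)] by (rule sym[OF trans])
qed (auto simp: D1_iff)

end
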